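(* For $n\ge 2$, $$\mathrm{GC}(F(\mathbb{R}^n,2))=\mathrm{TC}(F(\mathbb{R}^n,2))=\begin{cases}1 & n\text{ even}\\ 2 & n\text{ odd.}\end{cases}$$
   Context: $F(\mathbb{R}^n,2)$ denotes the space of ordered pairs of distinct points of $\mathbb{R}^n$, with the metric induced from the Euclidean metric on $\mathbb{R}^n\times\mathbb{R}^n$. Let $I=[0,1]$. For a topological space $Z$, $P(Z)=Z^I$ is the space of continuous maps $I\to Z$ with the compact-open topology, and $P(Z;z_0,z_1)$ is the subspace of paths from $z_0$ to $z_1$. The length of a path in a metric space is the supremum of the sums of distances between successive points on the path. A (minimal) geodesic from $x_0$ to $x_1$ in a metric space $(Z,d)$ is a path $\gamma$ from $x_0$ to $x_1$ with $d(\gamma(t),\gamma(t'))=|t-t'|\,d(x_0,x_1)$ for all $t,t'\in I$. A metric space is geodesic if every pair of its points is joined by a geodesic. Let $X$ be a metric space whose completion $\overline{X}$ is geodesic. For $x_0,x_1\in X$, a near-geodesic from $x_0$ to $x_1$ is a continuous map $\phi:I\to P(\overline{X};x_0,x_1)$ such that (i) $\phi(0)$ is a geodesic in $\overline{X}$ from $x_0$ to $x_1$; (ii) $\phi((0,1])\subset P(X;x_0,x_1)$; (iii) if $s_n\to 0$, then $\operatorname{length}(\phi(s_n))\to\operatorname{length}(\phi(0))$. For $E\subset X\times X$, a near-geodesic motion planning rule (NGMPR) on $E$ is a continuous map $\Phi:E\to P(\overline{X})^I$ such that, for all $(x_0,x_1)\in E$, $\Phi(x_0,x_1)$ is a near-geodesic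 from $x_0$ to $x_1$, with the additional proviso that $\Phi(x_0,x_1)(0)$ is a geodesic in $X$ if a geodesic in $X$ from $x_0$ to $x_1$ exists. The geodesic complexity $\mathrm{GC}(X)$ is the smallest $k$ such that $X\times X$ can be partitioned into locally compact sets $E_0,\ldots,E_k$ such that each $E_i$ has an NGMPR. The topological complexity $\mathrm{TC}(X)$ of a topological space $X$ (Farber, reduced version) is the smallest $k$ such that $X\times X$ can be partitioned into locally compact sets $E_0,\ldots,E_k$ on each of which there is a continuous map $s_i:E_i\to P(X)$ with $s_i(x_0,x_1)$ a path from $x_0$ to $x_1$ for all $(x_0,x_1)\in E_i$. *)

theory Defs
  imports "HOL-Analysis.Analysis"
begin

section \<open>Function spaces with the compact-open topology\<close>

text \<open>Elements are extensional (undefined off the domain), so that a point of the space is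
  determined by a map on the domain. Taking \<open>K = {}\<close> shows that the carrier is the
  set of all continuous maps.\<close>

definition compact_open_topology :: "'a topology \<Rightarrow> 'b topology \<Rightarrow> ('a \<Rightarrow> 'b) topology" where
  "compact_open_topology X Y = topology_generated_by
     {{f \<in> extensional (topspace X). continuous_map X Y f \<and> f ` K \<subseteq> U} |K U.
        compactin X K \<and> openin Y U}"

lemma topspace_compact_open_topology:
  "topspace (compact_open_topology X Y) =
     {f \<in> extensional (topspace X). continuous_map X Y f}"
  (is "_ = ?C")
proof -
  have "?C \<in> {{f \<in> extensional (topspace X). continuous_map X Y f \<and> f ` K \<subseteq> U} |K U.
        compactin X K \<and> openin Y U}"
    unfolding mem_Collect_eq by (rule exI[of _ "{}"], rule exI[of _ "{}"]) simp
  then show ?thesis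
    unfolding compact_open_topology_def topology_generated_by_topspace by blast
qed

definition path_space :: "'a topology \<Rightarrow> (real \<Rightarrow> 'a) topology" where
  "path_space Z = compact_open_topology (top_of_set {0..1}) Z"

definition paths_between :: "'a topology \<Rightarrow> 'a \<Rightarrow> 'a \<Rightarrow> (real \<Rightarrow> 'a) set" where
  "paths_between Z x y = {\<gamma> \<in> topspace (path_space Z). \<gamma> 0 = x \<and> \<gamma> 1 = y}"


section \<open>Topological complexity\<close>

text \<open>The members of a partition may be empty; this does not affect the least \<open>k\<close>.\<close>

definition locally_compact_partition :: "'a topology \<Rightarrow> nat \<Rightarrow> (nat \<Rightarrow> 'a set) \<Rightarrow> bool" where
  "locally_compact_partition T k E \<longleftrightarrow>
     (\<Union>i\<le>k. E i) = topspace T \<and> disjoint_family_on E {..k} \<and>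
     (\<forall>i\<le>k. locally_compact_space (subtopology T (E i)))"

definition motion_planning_rule ::
    "'a topology \<Rightarrow> ('a \<times> 'a) set \<Rightarrow> ('a \<times> 'a \<Rightarrow> real \<Rightarrow> 'a) \<Rightarrow> bool" where
  "motion_planning_rule X E s \<longleftrightarrow>
     continuous_map (subtopology (prod_topology X X) E) (path_space X) s \<and>
     (\<forall>(x, y) \<in> E. s (x, y) \<in> paths_between X x y)"

text \<open>Extended natural numbers: the infimum of the empty set is \<open>\<infinity>\<close>.\<close>

definition TC :: "'a topology \<Rightarrow> enat" where
  "TC X = Inf {enat k |k. \<exists>E. locally_compact_partition (prod_topology X X) k E \<and>
                 (\<forall>i\<le>k. \<exists>s. motion_planning_rule X (E i) s)}"


section \<open>Geodesic complexity\<close>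

definition length_of_path :: "(real \<Rightarrow> 'a::metric_space) \<Rightarrow> ennreal" where
  "length_of_path \<gamma> =
     (SUP ts \<in> {ts. ts \<noteq> [] \<and> sorted ts \<and> set ts \<subseteq> {0..1}}.
        \<Sum>i<length ts - 1. ennreal (dist (\<gamma> (ts ! i)) (\<gamma> (ts ! Suc i))))"

definition geodesic :: "'a::metric_space set \<Rightarrow> 'a \<Rightarrow> 'a \<Rightarrow> (real \<Rightarrow> 'a) \<Rightarrow> bool" where
  "geodesic Z x y \<gamma> \<longleftrightarrow>
     \<gamma> \<in> paths_between (top_of_set Z) x y \<and>
     (\<forall>t\<in>{0..1}. \<forall>t'\<in>{0..1}. dist (\<gamma> t) (\<gamma> t') = \<bar>t - t'\<bar> * dist x y)"

definition geodesic_space :: "'a::metric_space set \<Rightarrow> bool" where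
  "geodesic_space Z \<longleftrightarrow> (\<forall>x\<in>Z. \<forall>y\<in>Z. \<exists>\<gamma>. geodesic Z x y \<gamma>)"

text \<open>A metric space \<open>X\<close> is given as a subset of a complete metric space, with the induced
  metric; its completion is then the closure of \<open>X\<close>. The definitions below are meant for
  \<open>X\<close> with \<^term>\<open>geodesic_space (closure X)\<close>.\<close>

definition near_geodesic ::
    "'a::complete_space set \<Rightarrow> 'a \<Rightarrow> 'a \<Rightarrow> (real \<Rightarrow> real \<Rightarrow> 'a) \<Rightarrow> bool" where
  "near_geodesic X x y \<phi> \<longleftrightarrow>
     \<phi> \<in> topspace (path_space (subtopology (path_space (top_of_set (closure X)))
                       (paths_between (top_of_set (closure X)) x y))) \<and>
     geodesic (closure X) x y (\<phi> 0) \<and>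
     \<phi> ` {0<..1} \<subseteq> paths_between (top_of_set X) x y \<and>
     (\<forall>s :: nat \<Rightarrow> real. range s \<subseteq> {0..1} \<longrightarrow> s \<longlonglongrightarrow> 0 \<longrightarrow>
        (\<lambda>n. length_of_path (\<phi> (s n))) \<longlonglongrightarrow> length_of_path (\<phi> 0))"

definition NGMPR ::
    "'a::complete_space set \<Rightarrow> ('a \<times> 'a) set \<Rightarrow> ('a \<times> 'a \<Rightarrow> real \<Rightarrow> real \<Rightarrow> 'a) \<Rightarrow> bool" where
  "NGMPR X E \<Phi> \<longleftrightarrow>
     continuous_map (subtopology (prod_topology (top_of_set X) (top_of_set X)) E)
       (path_space (path_space (top_of_set (closure X)))) \<Phi> \<and>
     (\<forall>(x, y) \<in> E. near_geodesic X x y (\<Phi> (x, y)) \<and>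
        ((\<exists>\<gamma>. geodesic X x y \<gamma>) \<longrightarrow> geodesic X x y (\<Phi> (x, y) 0)))"

definition GC :: "'a::complete_space set \<Rightarrow> enat" where
  "GC X = Inf {enat k |k. \<exists>E.
             locally_compact_partition (prod_topology (top_of_set X) (top_of_set X)) k E \<and>
             (\<forall>i\<le>k. \<exists>\<Phi>. NGMPR X (E i) \<Phi>)}"


section \<open>Configuration spaces of two points\<close>

definition conf2 :: "'a set \<Rightarrow> ('a \<times> 'a) set" where
  "conf2 M = {(x, y). x \<in> M \<and> y \<in> M \<and> x \<noteq> y}"

lemma closure_conf2: "closure (conf2 (UNIV :: 'a::euclidean_space set)) = UNIV"
proof -
  have "(x, y) \<in> closure (conf2 UNIV)" for x y :: 'a
  proof (cases "x = y")
    case True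
    obtain f where f: "\<And>n. f n \<noteq> y" and lim: "f \<longlonglongrightarrow> y"
      using islimpt_UNIV[of y] unfolding islimpt_sequential by blast
    have "(\<lambda>n. (f n, y)) \<longlonglongrightarrow> (y, y)"
      by (intro tendsto_Pair lim tendsto_const)
    moreover have "\<forall>n. (f n, y) \<in> conf2 UNIV"
      using f by (auto simp: conf2_def)
    ultimately show ?thesis
      using True unfolding closure_sequential by (intro exI[of _ "\<lambda>n. (f n, y)"]) simp
  next
    case False
    then show ?thesis
      by (intro subsetD[OF closure_subset]) (simp add: conf2_def)
  qed
  then show ?thesis by auto
qed

lemma geodesic_space_closure_conf2:
  "geodesic_space (closure (conf2 (UNIV :: 'a::euclidean_space set)))"
  unfolding closure_conf2 geodesic_space_def
proof (intro ballI)
  fix p q :: "'a \<times> 'a"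
  define g where "g = restrict (linepath p q) {0..1}"
  have cont: "continuous_on {0..1} g"
    using continuous_on_linepath[of "{0..1}" p q] by (rule continuous_on_eq) (simp add: g_def)
  have "dist (g t) (g t') = \<bar>t - t'\<bar> * dist p q" if "t \<in> {0..1}" "t' \<in> {0..1}" for t t'
  proof -
    have "g t - g t' = (t' - t) *\<^sub>R (p - q)"
      using that by (simp add: g_def linepath_def algebra_simps)
    then show ?thesis by (simp add: dist_norm abs_minus_commute)
  qed
  then have "geodesic UNIV p q g"
    using cont
    by (auto simp: geodesic_def paths_between_def path_space_def
        topspace_compact_open_topology g_def linepath_def)
  then show "\<exists>\<gamma>. geodesic UNIV p q \<gamma>" by blast
qed

end

theory Submission
  imports Defs "HOL-Homology.Homology"
begin

text \<open>
  Write \<open>X\<close> for the space of pairs of distinct points of a Euclidean space \<open>V\<close> of dimension \<open>n\<close>, and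
  \<open>S\<close> for the unit sphere of \<open>V\<close>. The theorem follows from three inequalities.

  \<^item> \<open>TC X \<le> GC X\<close>, because a near-geodesic evaluated at the parameter 1 is a path in \<open>X\<close>
    (lemma \<open>TC_le_GC\<close>).

  \<^item> \<open>GC X\<close> is at most 1 or 2 (lemma \<open>GC_conf2_upper_bound\<close>). The straight line between two
    configurations leaves \<open>X\<close> only if the difference vectors \<open>d\<close>, \<open>d'\<close> of the two configurations
    are opposed, that is, if \<open>d'\<close> is a negative multiple of \<open>d\<close>. For opposed vectors the line is bent
    in a direction that is not a multiple of \<open>d\<close>; letting the amount of bending tend to 0 gives a
    near-geodesic. In even dimension a skew isomorphism \<open>J\<close> of \<open>V\<close> provides such a direction \<open>J d\<close>
    for all \<open>d\<close> at once. In odd dimension the direction is a fixed vector \<open>e\<close> as long as \<open>d\<close> is not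
    parallel to \<open>e\<close>, and a vector orthogonal to \<open>e\<close> on the remaining third set.

  \<^item> \<open>TC X\<close> is at least 1 or 2 (lemma \<open>TC_conf2_lower_bound\<close>). A planning rule on all of \<open>X \<times> X\<close>
    would contract \<open>S\<close>. So let \<open>n\<close> be odd, and suppose that two locally compact sets with planning
    rules partition \<open>X \<times> X\<close>. Restricted to \<open>S \<times> S\<close>, the rules are homotopies between the projections
    \<open>p\<close> and \<open>q\<close> on two locally closed sets that cover \<open>S \<times> S\<close>. Since spheres are neighbourhood
    retracts, these homotopies extend to open neighbourhoods; cut off near the boundaries of the
    neighbourhoods, they yield maps \<open>f\<close> and \<open>g\<close> on \<open>S \<times> S\<close>, both homotopic to \<open>p\<close>, such that everywhere
    \<open>f = q\<close> or \<open>g = q\<close>. This contradicts lemma \<open>homotopic_to_fst_common_antipode\<close>, by which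
    \<open>f = g = - q\<close> somewhere.

  That lemma is the heart of the matter. The sets \<open>f = - q\<close> and \<open>g = - q\<close> both represent the class of
  the antidiagonal of \<open>S \<times> S\<close>, whose self-intersection number is, up to sign, the Euler characteristic
  2 of the even-dimensional sphere \<open>S\<close>. Instead of developing intersection theory, the proof
  realizes this number as a degree. From \<open>f\<close> and \<open>g\<close> one builds an explicit map \<open>\<Psi>\<close> from the unit
  sphere of \<open>\<real> \<times> V \<times> V\<close> to the punctured space \<open>\<real> \<times> V \<times> V\<close> that meets the negative half of the
  first axis only where \<open>f = g = - q\<close>. If this never happens, then \<open>\<Psi>\<close> is null-homotopic. On
  the other hand \<open>\<Psi>\<close> depends on \<open>f\<close> and \<open>g\<close> only up to homotopy, and for \<open>f = g = p\<close> it deforms to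
  \<open>(\<tau>, z, w) \<mapsto> (2 * \<tau>\<^sup>2 - 1, - (\<tau> *\<^sub>R z), z + w)\<close>. In the coordinates \<open>\<tau>\<close>, \<open>z\<close>, \<open>z + w\<close> and up to
  rescaling, this is a suspension of the map of the \<open>n\<close>-sphere that doubles the distance from a pole
  and then reflects \<open>z\<close>; it has degree 2 or -2. That it is not null-homotopic is lemma
  \<open>suspended_double_not_null\<close>: a null-homotopy would make its restrictions to the two hemispheres
  homotopic relative to the equator, and hence \<open>(\<tau>, z, w) \<mapsto> (\<tau>, - z, w)\<close> homotopic to the identity,
  whereas the degree of that reflection is \<open>(-1)^n = -1\<close>.
\<close>

section \<open>Degrees of coordinate reflections\<close>

definition flip_coords :: "nat set \<Rightarrow> (nat \<Rightarrow> real) \<Rightarrow> nat \<Rightarrow> real" where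
  "flip_coords A x = (\<lambda>i. if i \<in> A then - x i else x i)"

lemma continuous_map_into_nsphere:
  assumes "\<And>i. i \<le> p \<Longrightarrow> continuous_map T euclideanreal (\<lambda>x. f x i)"
    and "\<And>x. x \<in> topspace T \<Longrightarrow> (\<Sum>i\<le>p. (f x i)\<^sup>2) = 1"
    and "\<And>x i. x \<in> topspace T \<Longrightarrow> i > p \<Longrightarrow> f x i = 0"
  shows "continuous_map T (nsphere p) f"
proof -
  have "continuous_map T euclideanreal (\<lambda>x. f x i)" for i
  proof (cases "i \<le> p")
    case False
    then have "continuous_map T euclideanreal (\<lambda>x. f x i) \<longleftrightarrow> continuous_map T euclideanreal (\<lambda>x. 0)"
      using assms(3) by (intro iffI; elim continuous_map_eq) auto
    then show ?thesis by simp
  qed (simp add: assms(1))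
  then have "continuous_map T (powertop_real UNIV) f"
    by (simp add: continuous_map_componentwise_UNIV)
  then show ?thesis
    using assms(2,3) by (auto simp: nsphere continuous_map_in_subtopology)
qed

lemma topspace_nsphere:
  "topspace (nsphere p) = {x. (\<Sum>i\<le>p. (x i)\<^sup>2) = 1 \<and> (\<forall>i>p. x i = 0)}"
  by (simp add: nsphere)

lemma continuous_map_flip_coords: "continuous_map (nsphere p) (nsphere p) (flip_coords A)"
proof (rule continuous_map_into_nsphere)
  show "continuous_map (nsphere p) euclideanreal (\<lambda>x. flip_coords A x i)" for i
    by (cases "i \<in> A") (auto simp: flip_coords_def intro!: continuous_intros continuous_map_nsphere_projection)
  show "(\<Sum>i\<le>p. (flip_coords A x i)\<^sup>2) = 1" if "x \<in> topspace (nsphere p)" for x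
  proof -
    have "(flip_coords A x i)\<^sup>2 = (x i)\<^sup>2" for i by (simp add: flip_coords_def)
    then show ?thesis using that by (simp add: topspace_nsphere)
  qed
qed (auto simp: flip_coords_def topspace_nsphere)

text \<open>For coordinate 0 this is \<open>Brouwer_degree2_reflection\<close>. Interchanging the coordinates 0
  and \<open>k\<close> is an involution, so its degree is 1 or -1, and conjugating with it changes nothing.\<close>
lemma Brouwer_degree2_flip_one:
  assumes "k \<le> p" shows "Brouwer_degree2 p (flip_coords {k}) = -1"
proof -
  define \<sigma> where "\<sigma> = (\<lambda>(x::nat \<Rightarrow> real) i. x (Transposition.transpose 0 k i))"
  have tr: "Transposition.transpose 0 k permutes {..p}"
    using assms by (intro permutes_swap_id) auto
  have \<sigma>: "continuous_map (nsphere p) (nsphere p) \<sigma>"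
  proof (rule continuous_map_into_nsphere)
    show "(\<Sum>i\<le>p. (\<sigma> x i)\<^sup>2) = 1" if "x \<in> topspace (nsphere p)" for x
      using that sum.permute[OF tr, of "\<lambda>i. (x i)\<^sup>2"] by (simp add: topspace_nsphere \<sigma>_def o_def)
    show "\<sigma> x i = 0" if "x \<in> topspace (nsphere p)" "p < i" for x i
      using that assms by (simp add: topspace_nsphere \<sigma>_def transpose_def)
  qed (auto simp: \<sigma>_def intro: continuous_map_nsphere_projection)
  have inv: "\<sigma> \<circ> \<sigma> = id" by (auto simp: \<sigma>_def fun_eq_iff)
  have r0: "Brouwer_degree2 p (flip_coords {0}) = -1"
    using Brouwer_degree2_reflection[of p] by (simp add: flip_coords_def[abs_def])
  have "flip_coords {k} = \<sigma> \<circ> (flip_coords {0} \<circ> \<sigma>)"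
    by (auto simp: fun_eq_iff flip_coords_def \<sigma>_def transpose_eq_iff)
  then have "Brouwer_degree2 p (flip_coords {k})
      = Brouwer_degree2 p \<sigma> * Brouwer_degree2 p \<sigma> * Brouwer_degree2 p (flip_coords {0})"
    using \<sigma> continuous_map_flip_coords by (simp add: Brouwer_degree2_compose continuous_map_compose)
  also have "Brouwer_degree2 p \<sigma> * Brouwer_degree2 p \<sigma> = 1"
    using Brouwer_degree2_compose[OF \<sigma> \<sigma>] by (simp add: inv)
  finally show ?thesis using r0 by simp
qed

lemma Brouwer_degree2_flip_coords:
  assumes "A \<subseteq> {..p}"
  shows "Brouwer_degree2 p (flip_coords A) = (-1) ^ card A"
proof -
  have "finite A" using assms finite_subset by blast
  then show ?thesis using assms
  proof (induction A)
    case empty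
    have "flip_coords {} = id" by (auto simp: flip_coords_def)
    then show ?case by (simp only: Brouwer_degree2_id card.empty power_0)
  next
    case (insert k A)
    have "flip_coords (insert k A) = flip_coords {k} \<circ> flip_coords A"
      using insert.hyps by (auto simp: fun_eq_iff flip_coords_def)
    then show ?case
      using insert Brouwer_degree2_compose[OF continuous_map_flip_coords[of p A] continuous_map_flip_coords[of p "{k}"]]
      by (simp only: Brouwer_degree2_flip_one insert_subset atMost_iff) simp
  qed
qed

text \<open>The degree is transported from the sphere of functions on the natural numbers by choosing an
  enumeration of the basis. Composing with radial projection turns a homotopy through nonzero
  vectors into one on the sphere.\<close>
theorem odd_reflection_not_homotopic_id:
  fixes \<rho> :: "'a::euclidean_space \<Rightarrow> 'a"
  assumes B: "B \<subseteq> Basis" "odd (card B)"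
    and \<rho>: "\<And>v b. b \<in> Basis \<Longrightarrow> \<rho> v \<bullet> b = (if b \<in> B then - (v \<bullet> b) else v \<bullet> b)"
  shows "\<not> homotopic_with_canon (\<lambda>_. True) (sphere 0 1) (- {0}) \<rho> id"
proof
  assume hom: "homotopic_with_canon (\<lambda>_. True) (sphere 0 1) (- {0}) \<rho> id"
  define p where "p = DIM('a) - 1"
  have p: "{..<DIM('a)} = {..p}" using DIM_positive[where 'a='a] by (auto simp: p_def simp del: DIM_positive)
  obtain b where b: "bij_betw b {..p} (Basis :: 'a set)"
    using ex_bij_betw_nat_finite[of "Basis :: 'a set"] by (auto simp: p[symmetric] atLeast0LessThan)
  define J where "J = (\<lambda>x. \<Sum>i\<le>p. x i *\<^sub>R b i)"
  \<comment> \<open>\<open>J\<close> embeds coordinate tuples linearly; \<open>K\<close> is its inverse after radial projection.\<close>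
  define K where "K = (\<lambda>v i. if i \<le> p then (v \<bullet> b i) / norm v else 0)"
  have bB: "b i \<in> Basis" if "i \<le> p" for i using b that by (auto simp: bij_betw_def)
  have bb: "b i \<bullet> b j = (if i = j then 1 else 0)" if "i \<le> p" "j \<le> p" for i j
    using b that bB by (auto simp: inner_Basis bij_betw_def inj_on_def)
  have Jb: "J x \<bullet> b j = x j" if "j \<le> p" for x j
  proof -
    have "J x \<bullet> b j = (\<Sum>i\<le>p. x i * (if i = j then 1 else 0))"
      using that by (auto simp: J_def inner_sum_left bb intro!: sum.cong)
    also have "\<dots> = x j" using that by (simp add: if_distrib cong: if_cong)
    finally show ?thesis .
  qed
  have norm2: "(\<Sum>i\<le>p. (v \<bullet> b i)\<^sup>2) = (norm v)\<^sup>2" for v :: 'a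
  proof -
    have "(\<Sum>i\<le>p. (v \<bullet> b i)\<^sup>2) = (\<Sum>u\<in>Basis. (v \<bullet> u)\<^sup>2)"
      by (rule sum.reindex_bij_betw[OF b])
    also have "\<dots> = v \<bullet> v"
      by (simp only: euclidean_inner[of v v] power2_eq_square)
    finally show ?thesis by (simp add: dot_square_norm)
  qed
  have nJ: "norm (J x) = 1" if "x \<in> topspace (nsphere p)" for x
  proof -
    have "(norm (J x))\<^sup>2 = (\<Sum>i\<le>p. (x i)\<^sup>2)" unfolding norm2[symmetric] by (intro sum.cong) (auto simp: Jb)
    then have "(norm (J x))\<^sup>2 = 1" using that by (simp add: topspace_nsphere)
    then show ?thesis using norm_ge_zero[of "J x"] by (simp add: power2_eq_1_iff del: norm_ge_zero)
  qed
  have J: "continuous_map (nsphere p) (top_of_set (sphere 0 1)) J"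
    unfolding continuous_map_in_subtopology
  proof (intro conjI)
    show "continuous_map (nsphere p) euclidean J"
    proof -
      have "continuous_map (nsphere p) euclidean (\<lambda>x. x i *\<^sub>R b i)" for i
        using continuous_map_compose[OF continuous_map_nsphere_projection[of p i], of euclidean "\<lambda>t. t *\<^sub>R b i"]
        by (simp add: o_def continuous_intros)
      then show ?thesis unfolding J_def by (intro continuous_map_sum) auto
    qed
    show "J \<in> topspace (nsphere p) \<rightarrow> sphere 0 1" using nJ by auto
  qed
  have K: "continuous_map (top_of_set (- {0})) (nsphere p) K"
  proof (rule continuous_map_into_nsphere)
    show "continuous_map (top_of_set (- {0})) euclideanreal (\<lambda>x. K x i)" if "i \<le> p" for i
      using that by (auto simp: K_def intro!: continuous_intros)
    show "(\<Sum>i\<le>p. (K v i)\<^sup>2) = 1" if "v \<in> topspace (top_of_set (- {0}))" for v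
    proof -
      have "(\<Sum>i\<le>p. (K v i)\<^sup>2) = (\<Sum>i\<le>p. (v \<bullet> b i)\<^sup>2) / (norm v)\<^sup>2"
        by (simp add: K_def power_divide sum_divide_distrib)
      then show ?thesis using that by (simp add: norm2)
    qed
  qed (simp add: K_def)
  have "homotopic_with (\<lambda>_. True) (nsphere p) (nsphere p) (K \<circ> (\<rho> \<circ> J)) (K \<circ> (id \<circ> J))"
    by (intro homotopic_with_compose_continuous_map_left[OF _ K]
        homotopic_with_compose_continuous_map_right[OF hom J]) auto
  then have eq: "Brouwer_degree2 p (K \<circ> (\<rho> \<circ> J)) = Brouwer_degree2 p (K \<circ> (id \<circ> J))"
    by (rule Brouwer_degree2_homotopic)
  define A where "A = {i \<in> {..p}. b i \<in> B}"
  have "bij_betw b A B"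
    unfolding bij_betw_def
  proof
    show "inj_on b A" using b by (auto simp: A_def bij_betw_def inj_on_def)
    show "b ` A = B" using b B by (auto simp: A_def bij_betw_def)
  qed
  then have cA: "odd (card A)" using B bij_betw_same_card by metis
  have n\<rho>: "norm (\<rho> v) = norm v" for v
  proof -
    have "(norm (\<rho> v))\<^sup>2 = (norm v)\<^sup>2" unfolding norm2[symmetric] by (intro sum.cong) (auto simp: \<rho> bB)
    then show ?thesis by simp
  qed
  have "Brouwer_degree2 p (K \<circ> (\<rho> \<circ> J)) = Brouwer_degree2 p (flip_coords A)"
    by (intro Brouwer_degree2_eq) (auto simp: fun_eq_iff K_def flip_coords_def A_def n\<rho> nJ \<rho> bB Jb topspace_nsphere)
  moreover have "Brouwer_degree2 p (K \<circ> (id \<circ> J)) = Brouwer_degree2 p id"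
    by (intro Brouwer_degree2_eq) (auto simp: fun_eq_iff K_def nJ Jb topspace_nsphere)
  ultimately show False
    using eq Brouwer_degree2_flip_coords[of A p] cA by (auto simp: A_def)
qed

section \<open>A suspension of a map of degree two is essential\<close>

lemma homotopic_canonI:
  assumes "continuous_on ({0..1::real} \<times> S) h" "\<And>t x. t \<in> {0..1} \<Longrightarrow> x \<in> S \<Longrightarrow> h (t, x) \<in> T"
    and "\<And>x. x \<in> S \<Longrightarrow> h (0, x) = f x" "\<And>x. x \<in> S \<Longrightarrow> h (1, x) = g x"
  shows "homotopic_with_canon (\<lambda>_. True) S T f g"
proof -
  have "h \<in> {0..1} \<times> S \<rightarrow> T" using assms(2) by auto
  then show ?thesis using assms(1,3,4) by (subst homotopic_with) (auto intro!: exI[of _ h])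
qed

lemma homotopic_canonE:
  assumes "homotopic_with_canon (\<lambda>_. True) S T f g"
  obtains h where "continuous_on ({0..1::real} \<times> S) h" "h \<in> {0..1} \<times> S \<rightarrow> T"
    "\<And>x. h (0, x) = f x" "\<And>x. h (1, x) = g x"
  using assms by (auto simp: homotopic_with_def)

lemma homotopic_punctured_linear:
  fixes f g :: "_ \<Rightarrow> 'b::real_normed_vector"
  assumes "continuous_on S f" "continuous_on S g"
    and "\<And>x r. x \<in> S \<Longrightarrow> 0 \<le> r \<Longrightarrow> r \<le> 1 \<Longrightarrow> (1 - r) *\<^sub>R f x + r *\<^sub>R g x \<noteq> 0"
  shows "homotopic_with_canon (\<lambda>_. True) S (- {0}) f g"
  using assms by (intro homotopic_with_linear) (auto simp: closed_segment_def)

text \<open>On the unit sphere of \<open>\<real> \<times> 'a \<times> 'a\<close> the map takes points with the same \<open>z\<close>, \<open>w\<close> and opposite \<open>\<tau>\<close> to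
  values that differ by the sign of the middle component. A null-homotopy extends the map to the
  ball, and sliding along the vertical chords of the ball is then a homotopy between the two
  restrictions to hemispheres, relative to the equator. Gluing it to one fixed map on the
  other hemisphere yields homotopic maps, which deform linearly to \<open>(\<tau>, - z, w)\<close> and \<open>(\<tau>, z, w)\<close>.\<close>
theorem suspended_double_not_null:
  assumes odd: "odd DIM('a::euclidean_space)"
  shows "\<not> homotopic_with_canon (\<lambda>_. True) (sphere 0 1) (- {0})
           (\<lambda>(\<tau>, z, w). (2 * \<tau>\<^sup>2 - 1, - (\<tau> *\<^sub>R z), z + w) :: real \<times> 'a \<times> 'a) (\<lambda>_. c)"
proof
  define S where "S = (sphere 0 1 :: (real \<times> 'a \<times> 'a) set)"
  define L where "L = (\<lambda>(\<tau>, z, w). (2 * \<tau>\<^sup>2 - 1, - (\<tau> *\<^sub>R z), z + w) :: real \<times> 'a \<times> 'a)"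
  assume "homotopic_with_canon (\<lambda>_. True) (sphere 0 1) (- {0})
           (\<lambda>(\<tau>, z, w). (2 * \<tau>\<^sup>2 - 1, - (\<tau> *\<^sub>R z), z + w) :: real \<times> 'a \<times> 'a) (\<lambda>_. c)"
  then have "\<exists>c. homotopic_with_canon (\<lambda>_. True) (sphere 0 1) (- {0}) L (\<lambda>_. c)"
    unfolding L_def by blast
  then obtain \<Phi> where \<Phi>: "continuous_on (cball 0 1) \<Phi>" "\<Phi> ` cball 0 1 \<subseteq> - {0}" "\<And>P. P \<in> S \<Longrightarrow> \<Phi> P = L P"
    unfolding nullhomotopic_from_sphere_extension S_def by blast
  have normS: "\<tau>\<^sup>2 + (norm z)\<^sup>2 + (norm w)\<^sup>2 = 1" if "(\<tau>, z, w) \<in> S" for \<tau> z w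
    using that by (simp add: S_def norm_Pair real_sqrt_eq_1_iff)
  have slab: "((1 - 2 * s) * \<tau>, z, w) \<in> cball 0 1" if "(\<tau>, z, w) \<in> S" "0 \<le> s" "s \<le> 1" for s \<tau> z w
  proof -
    have "\<bar>1 - 2 * s\<bar> \<le> 1" using that by (simp add: abs_if)
    then have "((1 - 2 * s) * \<tau>)\<^sup>2 \<le> \<tau>\<^sup>2"
      by (simp add: power_mult_distrib abs_square_le_1 mult_left_le_one_le)
    then show ?thesis
      using normS[OF that(1)] by (simp add: norm_Pair)
  qed
  \<comment> \<open>On the equator \<open>\<tau> = 0\<close> the map has the value \<open>(- 1, 0, z + w)\<close>, so this formula can serve on the whole lower hemisphere.\<close>
  define G where "G = (\<lambda>(s::real, P::real \<times> 'a \<times> 'a). if fst P \<le> 0 then (- 1, 0, fst (snd P) + snd (snd P))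
      else \<Phi> ((1 - 2 * s) * fst P, fst (snd P), snd (snd P)))"
  have contG: "continuous_on ({0..1} \<times> S) G"
    unfolding G_def split_beta
  proof (rule continuous_on_cases_le)
    show "continuous_on {x \<in> {0..1} \<times> S. 0 \<le> fst (snd x)}
      (\<lambda>x. \<Phi> ((1 - 2 * fst x) * fst (snd x), fst (snd (snd x)), snd (snd (snd x))))"
      by (intro continuous_on_compose2[OF \<Phi>(1)] continuous_intros) (use slab in auto)
    show "(- 1, 0, fst (snd (snd x)) + snd (snd (snd x))) =
         \<Phi> ((1 - 2 * fst x) * fst (snd x), fst (snd (snd x)), snd (snd (snd x)))"
      if "x \<in> {0..1} \<times> S" "fst (snd x) = 0" for x
      using that \<Phi>(3)[of "snd x"] by (cases x) (auto simp: L_def split_beta)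
  qed (intro continuous_intros)+
  have G: "homotopic_with_canon (\<lambda>_. True) S (- {0}) (\<lambda>P. G (0, P)) (\<lambda>P. G (1, P))"
  proof (rule homotopic_canonI[OF contG])
    show "G (s, P) \<in> - {0}" if "s \<in> {0..1}" "P \<in> S" for s P
    proof (cases P)
      case (fields \<tau> z w)
      then show ?thesis
        using that imageI[OF slab[of \<tau> z w s], of \<Phi>] \<Phi>(2) by (auto simp: G_def zero_prod_def simp del: mem_cball)
    qed
  qed auto
  have contGs: "continuous_on S (\<lambda>P. G (s, P))" if "s \<in> {0..1}" for s
    using that by (intro continuous_on_compose2[OF contG] continuous_intros) auto
  have G01: "G (0, (\<tau>, z, w)) = (if \<tau> \<le> 0 then (-1, 0, z + w) else (2 * \<tau>\<^sup>2 - 1, - (\<tau> *\<^sub>R z), z + w))"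
       "G (1, (\<tau>, z, w)) = (if \<tau> \<le> 0 then (-1, 0, z + w) else (2 * \<tau>\<^sup>2 - 1, \<tau> *\<^sub>R z, z + w))"
    if "(\<tau>, z, w) \<in> S" for \<tau> z w
  proof -
    have "(- \<tau>, z, w) \<in> S" using that by (simp add: S_def norm_Pair)
    then show "G (0, (\<tau>, z, w)) = (if \<tau> \<le> 0 then (-1, 0, z + w) else (2 * \<tau>\<^sup>2 - 1, - (\<tau> *\<^sub>R z), z + w))"
       "G (1, (\<tau>, z, w)) = (if \<tau> \<le> 0 then (-1, 0, z + w) else (2 * \<tau>\<^sup>2 - 1, \<tau> *\<^sub>R z, z + w))"
      using that \<Phi>(3) by (simp_all add: G_def L_def)
  qed
  \<comment> \<open>The case \<open>\<epsilon> = -1\<close> is used for the start of the homotopy \<open>G\<close>, the case \<open>\<epsilon> = 1\<close> for its end.\<close>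
  have step: "(1 - r) *\<^sub>R (if \<tau> \<le> 0 then (-1, 0, z + w) else (2 * \<tau>\<^sup>2 - 1, \<epsilon> *\<^sub>R \<tau> *\<^sub>R z, z + w))
       + r *\<^sub>R (\<tau>, \<epsilon> *\<^sub>R z, z + w) \<noteq> 0"
    if "(\<tau>, z, w) \<in> S" "0 \<le> r" "r \<le> 1" "\<epsilon> \<noteq> 0" for r \<tau> \<epsilon> :: real and z w
  proof
    assume eq: "(1 - r) *\<^sub>R (if \<tau> \<le> 0 then (-1, 0, z + w) else (2 * \<tau>\<^sup>2 - 1, \<epsilon> *\<^sub>R \<tau> *\<^sub>R z, z + w))
       + r *\<^sub>R (\<tau>, \<epsilon> *\<^sub>R z, z + w) = 0"
    have "z + w = (1 - r) *\<^sub>R (z + w) + r *\<^sub>R (z + w)" by (simp add: algebra_simps)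
    also have "\<dots> = 0" using eq by (simp add: zero_prod_def split: if_splits)
    finally have w: "w = - z" by (simp add: eq_neg_iff_add_eq_0 add.commute)
    show False
    proof (cases "\<tau> \<le> 0")
      case True
      then have *: "r * \<tau> = 1 - r" "r *\<^sub>R z = 0"
        using eq \<open>\<epsilon> \<noteq> 0\<close> by (simp_all add: zero_prod_def)
      have "r * \<tau> \<le> 0" using True that by (simp add: mult_nonneg_nonpos)
      then have "r = 1" using * that by linarith
      then show False using * w normS[OF that(1)] by simp
    next
      case False
      then have "((1 - r) * \<tau> + r) *\<^sub>R (\<epsilon> *\<^sub>R z) = 0"
        using eq by (simp add: zero_prod_def algebra_simps)
      moreover have "(1 - r) * \<tau> + r > 0"
        using False that by (cases "r = 0") (auto intro: add_nonneg_pos)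
      ultimately have z: "z = 0" using \<open>\<epsilon> \<noteq> 0\<close> by simp
      then have "\<tau>\<^sup>2 = 1" using w normS[OF that(1)] by simp
      then have "\<tau> = 1" using False by (simp add: power2_eq_1_iff)
      then show False using eq False by (simp add: zero_prod_def)
    qed
  qed
  have lin: "homotopic_with_canon (\<lambda>_. True) S (- {0}) (\<lambda>P. G (0, P)) (\<lambda>(\<tau>, z, w). (\<tau>, - z, z + w))"
            "homotopic_with_canon (\<lambda>_. True) S (- {0}) (\<lambda>P. G (1, P)) (\<lambda>(\<tau>, z, w). (\<tau>, z, z + w))"
    using contGs[of 0] contGs[of 1] step[where \<epsilon>="-1", unfolded scaleR_minus1_left]
      step[where \<epsilon>=1, unfolded scaleR_one]
    by (auto simp: G01 split_beta intro!: homotopic_punctured_linear continuous_intros)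
  have shear: "homotopic_with_canon (\<lambda>_. True) S (- {0}) (\<lambda>(\<tau>, z, w). (\<tau>, \<epsilon> *\<^sub>R z, z + w)) (\<lambda>(\<tau>, z, w). (\<tau>, \<epsilon> *\<^sub>R z, w))"
    if "\<epsilon> \<noteq> 0" for \<epsilon> :: real
  proof (rule homotopic_punctured_linear)
    fix P r assume P: "P \<in> S" and "0 \<le> r" "(r::real) \<le> 1"
    obtain \<tau> z w where "P = (\<tau>, z, w)" by (cases P)
    moreover have False if 0: "(1 - r) * \<tau> + r * \<tau> = 0" "(1 - r) *\<^sub>R (\<epsilon> *\<^sub>R z) + r *\<^sub>R (\<epsilon> *\<^sub>R z) = 0"
        "(1 - r) *\<^sub>R (z + w) + r *\<^sub>R w = 0"
    proof -
      have "\<epsilon> *\<^sub>R z = 0" using 0(2) by (simp add: algebra_simps)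
      then have "z = 0" using \<open>\<epsilon> \<noteq> 0\<close> by simp
      moreover have "\<tau> = 0" using 0(1) by (simp add: algebra_simps)
      moreover have "w = 0" using 0(3) \<open>z = 0\<close> by (simp add: algebra_simps)
      ultimately show False using P normS \<open>P = (\<tau>, z, w)\<close> by fastforce
    qed
    ultimately show "(1 - r) *\<^sub>R (case P of (\<tau>, z, w) \<Rightarrow> (\<tau>, \<epsilon> *\<^sub>R z, z + w)) +
           r *\<^sub>R (case P of (\<tau>, z, w) \<Rightarrow> (\<tau>, \<epsilon> *\<^sub>R z, w)) \<noteq> 0"
      by (auto simp: zero_prod_def)
  qed (auto simp: split_beta intro!: continuous_intros)
  define \<rho> where "\<rho> = (\<lambda>(\<tau>, z, w). (\<tau>, - z, w) :: real \<times> 'a \<times> 'a)"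
  have "homotopic_with_canon (\<lambda>_. True) S (- {0}) \<rho> id"
    using shear[of "-1"] shear[of 1] lin G
    by (simp add: \<rho>_def id_def case_prod_unfold del: homotopic_with_canon_on_empty)
       (meson homotopic_with_sym homotopic_with_trans)
  moreover have "\<not> homotopic_with_canon (\<lambda>_. True) S (- {0}) \<rho> id"
    unfolding S_def
  proof (rule odd_reflection_not_homotopic_id)
    define B where "B = (\<lambda>u. (0, u, 0) :: real \<times> 'a \<times> 'a) ` Basis"
    show "B \<subseteq> Basis" by (auto simp: B_def Basis_prod_def)
    have "inj_on (\<lambda>u. (0, u, 0) :: real \<times> 'a \<times> 'a) Basis" by (auto simp: inj_on_def)
    then show "odd (card B)" using odd by (simp add: B_def card_image)
    show "\<rho> v \<bullet> b = (if b \<in> B then - (v \<bullet> b) else v \<bullet> b)" if "b \<in> Basis" for v b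
      using that by (auto simp: \<rho>_def B_def Basis_prod_def split_beta inner_prod_def)
  qed
  ultimately show False by contradiction
qed

section \<open>Self-intersection of the antidiagonal\<close>

text \<open>The weight \<open>\<phi>\<close> makes up for the values of \<open>g\<close> at the zeros of \<open>\<phi>\<close>, where \<open>g\<close> is
  bounded nearby but need not have a limit. This is how functions of the directions \<open>sgn z\<close> and \<open>sgn w\<close> are extended over
  \<open>z = 0\<close> and \<open>w = 0\<close>.\<close>
lemma continuous_on_weighted:
  fixes g :: "'a::metric_space \<Rightarrow> 'b::real_normed_vector"
  assumes \<phi>: "continuous_on T \<phi>" and g: "continuous_on {x \<in> T. \<phi> x \<noteq> 0} g"
    and bound: "\<And>x. x \<in> T \<Longrightarrow> \<phi> x \<noteq> 0 \<Longrightarrow> norm (g x) \<le> C"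
  shows "continuous_on T (\<lambda>x. \<phi> x *\<^sub>R g x)"
  unfolding continuous_on_def
proof
  fix x assume x: "x \<in> T"
  show "((\<lambda>x. \<phi> x *\<^sub>R g x) \<longlongrightarrow> \<phi> x *\<^sub>R g x) (at x within T)"
  proof (cases "\<phi> x = 0")
    case True
    have "((\<lambda>x. \<bar>\<phi> x\<bar> * \<bar>C\<bar>) \<longlongrightarrow> \<bar>\<phi> x\<bar> * \<bar>C\<bar>) (at x within T)"
      using \<phi> x by (auto simp: continuous_on_def intro!: tendsto_intros)
    then have lim: "((\<lambda>x. \<bar>\<phi> x\<bar> * \<bar>C\<bar>) \<longlongrightarrow> 0) (at x within T)" using True by simp
    have "norm (\<phi> y *\<^sub>R g y) \<le> \<bar>\<phi> y\<bar> * \<bar>C\<bar>" if "y \<in> T" for y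
      using bound[OF that] by (cases "\<phi> y = 0") (auto intro!: mult_left_mono)
    then have "((\<lambda>x. \<phi> x *\<^sub>R g x) \<longlongrightarrow> 0) (at x within T)"
      by (intro Lim_null_comparison[OF _ lim]) (auto simp: eventually_at_filter)
    then show ?thesis using True by simp
  next
    case False
    have "openin (top_of_set T) (T \<inter> \<phi> -` (- {0}))"
      using \<phi> by (intro continuous_openin_preimage_gen) auto
    then obtain U where U: "open U" "T \<inter> \<phi> -` (- {0}) = T \<inter> U" by (auto simp: openin_open)
    then have mem: "y \<in> U \<longleftrightarrow> \<phi> y \<noteq> 0" if "y \<in> T" for y
      using that by (auto simp: set_eq_iff)
    have "continuous_on {x \<in> T. \<phi> x \<noteq> 0} (\<lambda>x. \<phi> x *\<^sub>R g x)"
      using g continuous_on_subset[OF \<phi>, of "{x \<in> T. \<phi> x \<noteq> 0}"] by (intro continuous_intros) auto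
    then have "((\<lambda>x. \<phi> x *\<^sub>R g x) \<longlongrightarrow> \<phi> x *\<^sub>R g x) (at x within {x \<in> T. \<phi> x \<noteq> 0})"
      using False x by (simp add: continuous_on_def)
    moreover have "T \<inter> U - {x} = {x \<in> T. \<phi> x \<noteq> 0} \<inter> U - {x}" using mem by auto
    then have "at x within T = at x within {x \<in> T. \<phi> x \<noteq> 0}"
      using at_within_nhd[of x U] U(1) mem False x by blast
    ultimately show ?thesis by simp
  qed
qed

text \<open>For a point \<open>(\<tau>, z, w)\<close> of the unit sphere of \<open>\<real> \<times> 'a \<times> 'a\<close> with \<open>z\<close> and \<open>w\<close> nonzero, put \<open>a = sgn z\<close> and
  \<open>c = sgn w\<close>. The vectors \<open>(1 + \<tau>) *\<^sub>R c + (1 - \<tau>) *\<^sub>R f (a, c)\<close> and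
  \<open>norm w *\<^sub>R c + norm z *\<^sub>R g (a, c)\<close> both vanish only if \<open>f (a, c) = g (a, c) = - c\<close>, \<open>\<tau> = 0\<close> and
  \<open>norm z = norm w\<close>. Weighted by \<open>norm z * norm w\<close> they are the last two components of \<open>\<Psi>\<close>. The first
  component is 1 where the weight is 0 and -1 at such common zeros, where the weight is \<open>1/2\<close>; so
  \<open>\<Psi>\<close> avoids 0 in any case, and it avoids the negative half of the first axis unless
  \<open>f = g = - c\<close> somewhere.\<close>
theorem homotopic_to_fst_common_antipode:
  fixes f g :: "'a::euclidean_space \<times> 'a \<Rightarrow> 'a"
  defines "S \<equiv> sphere 0 1"
  assumes odd: "odd DIM('a)"
    and f: "homotopic_with_canon (\<lambda>_. True) (S \<times> S) S f fst"
    and g: "homotopic_with_canon (\<lambda>_. True) (S \<times> S) S g fst"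
  obtains a c where "a \<in> S" "c \<in> S" "f (a, c) = - c" "g (a, c) = - c"
proof -
  obtain h where h: "continuous_on ({0..1::real} \<times> (S \<times> S)) h" "h \<in> {0..1} \<times> (S \<times> S) \<rightarrow> S"
    "\<And>x. h (0, x) = f x" "\<And>x. h (1, x) = fst x" using f by (rule homotopic_canonE) blast
  obtain k where k: "continuous_on ({0..1::real} \<times> (S \<times> S)) k" "k \<in> {0..1} \<times> (S \<times> S) \<rightarrow> S"
    "\<And>x. k (0, x) = g x" "\<And>x. k (1, x) = fst x" using g by (rule homotopic_canonE) blast
  define \<Sigma> where "\<Sigma> = (sphere 0 1 :: (real \<times> 'a \<times> 'a) set)"
  have norm\<Sigma>: "\<tau>\<^sup>2 + (norm z)\<^sup>2 + (norm w)\<^sup>2 = 1" if "(\<tau>, z, w) \<in> \<Sigma>" for \<tau> z w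
    using that by (simp add: \<Sigma>_def norm_Pair real_sqrt_eq_1_iff)
  have sgnS: "sgn z \<in> S" if "z \<noteq> 0" for z using that by (simp add: S_def norm_sgn)
  have hS: "norm (h (t, a, c)) = 1" "norm (k (t, a, c)) = 1" if "t \<in> {0..1}" "a \<in> S" "c \<in> S" for t a c
    using funcset_mem[OF h(2), of "(t, a, c)"] funcset_mem[OF k(2), of "(t, a, c)"] that by (auto simp: S_def)
  \<comment> \<open>The extra variable \<open>t\<close> is the parameter of the homotopies \<open>h\<close> and \<open>k\<close> from \<open>f\<close> and \<open>g\<close> to \<open>fst\<close>.\<close>
  define \<mu> where "\<mu> = (\<lambda>(t::real, \<tau>::real, z::'a, w::'a). norm z * norm w)"
  define \<alpha> where "\<alpha> = (\<lambda>(t, \<tau>, z, w). (1 + \<tau>) *\<^sub>R sgn w + (1 - \<tau>) *\<^sub>R h (t, sgn z, sgn w))"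
  define \<beta> where "\<beta> = (\<lambda>(t, \<tau>::real, z, w). norm w *\<^sub>R sgn w + norm z *\<^sub>R k (t, sgn z, sgn w))"
  define \<Psi> where "\<Psi> = (\<lambda>x. (1 - 4 * \<mu> x, \<mu> x *\<^sub>R \<alpha> x, \<mu> x *\<^sub>R \<beta> x))"
  have small: "\<bar>\<tau>\<bar> \<le> 1" "norm z \<le> 1" "norm w \<le> 1" if "(\<tau>, z, w) \<in> \<Sigma>" for \<tau> z w
  proof -
    have "\<tau>\<^sup>2 \<le> 1" "(norm z)\<^sup>2 \<le> 1" "(norm w)\<^sup>2 \<le> 1"
      using norm\<Sigma>[OF that] zero_le_power2[of \<tau>] zero_le_power2[of "norm z"] zero_le_power2[of "norm w"] by linarith+
    then show "\<bar>\<tau>\<bar> \<le> 1" "norm z \<le> 1" "norm w \<le> 1"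
      by (simp_all add: abs_square_le_1)
  qed
  have cont\<mu>: "continuous_on T \<mu>" for T
    unfolding \<mu>_def split_beta by (intro continuous_intros)
  have contsgn: "continuous_on {x \<in> {0..1} \<times> \<Sigma>. \<mu> x \<noteq> 0} (\<lambda>x. sgn (fst (snd (snd x))))"
      "continuous_on {x \<in> {0..1} \<times> \<Sigma>. \<mu> x \<noteq> 0} (\<lambda>x. sgn (snd (snd (snd x))))"
    by (intro continuous_intros; auto simp: \<mu>_def)+
  have "continuous_on {x \<in> {0..1} \<times> \<Sigma>. \<mu> x \<noteq> 0} (\<lambda>x. h (fst x, sgn (fst (snd (snd x))), sgn (snd (snd (snd x)))))"
       "continuous_on {x \<in> {0..1} \<times> \<Sigma>. \<mu> x \<noteq> 0} (\<lambda>x. k (fst x, sgn (fst (snd (snd x))), sgn (snd (snd (snd x)))))"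
    by (intro continuous_on_compose2[OF h(1)] continuous_on_compose2[OF k(1)] continuous_intros contsgn;
        auto simp: \<mu>_def intro!: sgnS)+
  then have cont\<alpha>\<beta>: "continuous_on {x \<in> {0..1} \<times> \<Sigma>. \<mu> x \<noteq> 0} \<alpha>" "continuous_on {x \<in> {0..1} \<times> \<Sigma>. \<mu> x \<noteq> 0} \<beta>"
    unfolding \<alpha>_def \<beta>_def split_beta by - (intro continuous_intros contsgn; assumption)+
  have cont\<Psi>: "continuous_on ({0..1} \<times> \<Sigma>) \<Psi>"
    unfolding \<Psi>_def
  \<comment> \<open>On the unit sphere all coefficients in \<open>\<alpha>\<close> and \<open>\<beta>\<close> are at most 2, and there are two terms.\<close>
  proof (intro continuous_on_Pair continuous_on_weighted[where C = 4] cont\<mu> cont\<alpha>\<beta> continuous_intros)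
    fix x assume "x \<in> {0..1} \<times> \<Sigma>" "\<mu> x \<noteq> 0"
    then obtain t \<tau> z w where x: "x = (t, \<tau>, z, w)" "t \<in> {0..1}" "(\<tau>, z, w) \<in> \<Sigma>" "z \<noteq> 0" "w \<noteq> 0"
      by (cases x) (auto simp: \<mu>_def)
    have hk: "norm (h (t, sgn z, sgn w)) = 1" "norm (k (t, sgn z, sgn w)) = 1"
      using hS x sgnS by auto
    have "norm (\<alpha> x) \<le> norm ((1 + \<tau>) *\<^sub>R sgn w) + norm ((1 - \<tau>) *\<^sub>R h (t, sgn z, sgn w))"
      unfolding x(1) \<alpha>_def by (simp only: prod.case norm_triangle_ineq)
    also have "\<dots> \<le> 4" using hk x small(1)[OF x(3)] by (simp add: norm_sgn)
    finally show "norm (\<alpha> x) \<le> 4" .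
    have "norm (\<beta> x) \<le> norm (norm w *\<^sub>R sgn w) + norm (norm z *\<^sub>R k (t, sgn z, sgn w))"
      unfolding x(1) \<beta>_def by (simp only: prod.case norm_triangle_ineq)
    also have "\<dots> \<le> 4" using hk x small(2,3)[OF x(3)] by (simp add: norm_sgn)
    finally show "norm (\<beta> x) \<le> 4" .
  qed
  have zero: "h (t, sgn z, sgn w) = - sgn w \<and> k (t, sgn z, sgn w) = - sgn w \<and> norm z * norm w = 1 / 2"
    if "t \<in> {0..1}" "(\<tau>, z, w) \<in> \<Sigma>" "z \<noteq> 0" "w \<noteq> 0" "\<alpha> (t, \<tau>, z, w) = 0" "\<beta> (t, \<tau>, z, w) = 0" for t \<tau> z w
  proof -
    have hk: "norm (h (t, sgn z, sgn w)) = 1" "norm (k (t, sgn z, sgn w)) = 1"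
      using hS that sgnS by auto
    have \<alpha>: "(1 + \<tau>) *\<^sub>R sgn w = - ((1 - \<tau>) *\<^sub>R h (t, sgn z, sgn w))"
      using that(5) by (simp add: \<alpha>_def eq_neg_iff_add_eq_0)
    have "norm ((1 + \<tau>) *\<^sub>R sgn w) = norm ((1 - \<tau>) *\<^sub>R h (t, sgn z, sgn w))"
      unfolding \<alpha> by simp
    then have "\<bar>1 + \<tau>\<bar> = \<bar>1 - \<tau>\<bar>" using hk that by (simp add: norm_sgn)
    then have \<tau>: "\<tau> = 0" by linarith
    have \<beta>: "norm w *\<^sub>R sgn w = - (norm z *\<^sub>R k (t, sgn z, sgn w))"
      using that(6) by (simp add: \<beta>_def eq_neg_iff_add_eq_0)
    have "norm (norm w *\<^sub>R sgn w) = norm (norm z *\<^sub>R k (t, sgn z, sgn w))"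
      unfolding \<beta> by simp
    then have wz: "norm w = norm z" using hk that by (simp add: norm_sgn)
    have "k (t, sgn z, sgn w) = - sgn w"
    proof -
      have "norm z *\<^sub>R (sgn w + k (t, sgn z, sgn w)) = 0" using \<beta> wz by (simp add: algebra_simps)
      then show ?thesis using that(3) by (simp add: eq_neg_iff_add_eq_0 add.commute)
    qed
    moreover have "norm z * norm w = 1 / 2" using norm\<Sigma>[OF that(2)] \<tau> wz by (simp add: power2_eq_square)
    moreover have "sgn w = - h (t, sgn z, sgn w)" using \<alpha> \<tau> by simp
    then have "h (t, sgn z, sgn w) = - sgn w" by (metis minus_minus)
    ultimately show ?thesis by simp
  qed
  have hom: "homotopic_with_canon (\<lambda>_. True) \<Sigma> (- {0}) (\<lambda>P. \<Psi> (0, P)) (\<lambda>P. \<Psi> (1, P))"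
  proof (rule homotopic_canonI[OF cont\<Psi>])
    fix t P assume t: "t \<in> {0..1::real}" and P: "P \<in> \<Sigma>"
    obtain \<tau> z w where Pe: "P = (\<tau>, z, w)" by (cases P)
    show "\<Psi> (t, P) \<in> - {0}"
      using zero[of t \<tau> z w] t P Pe
      by (cases "z = 0 \<or> w = 0") (auto simp: \<Psi>_def \<mu>_def zero_prod_def)
  qed auto
  have cont: "continuous_on \<Sigma> (\<lambda>P. \<Psi> (t, P))" if "t \<in> {0..1}" for t
    using that by (intro continuous_on_compose2[OF cont\<Psi>] continuous_intros) auto
  \<comment> \<open>For \<open>f = g = fst\<close> the factors \<open>norm z\<close> and \<open>norm w\<close> turn all directions back into \<open>z\<close> and \<open>w\<close>.\<close>
  have end1: "\<Psi> (1, \<tau>, z, w) = (1 - 4 * (norm z * norm w), (1 + \<tau>) *\<^sub>R norm z *\<^sub>R w + (1 - \<tau>) *\<^sub>R norm w *\<^sub>R z,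
      (norm z * norm w) *\<^sub>R (z + w))" for \<tau> z w
  proof -
    have n: "norm x *\<^sub>R sgn x = x" for x :: 'a by (cases "x = 0") (simp_all add: sgn_div_norm)
    have sc: "(norm z * norm w * s) *\<^sub>R sgn w = (s * norm z) *\<^sub>R w"
      "(norm z * norm w * s) *\<^sub>R sgn z = (s * norm w) *\<^sub>R z" for s
      using arg_cong[OF n[of w], of "\<lambda>v. (s * norm z) *\<^sub>R v"] arg_cong[OF n[of z], of "\<lambda>v. (s * norm w) *\<^sub>R v"]
      by (simp_all add: mult_ac)
    show ?thesis
      by (simp add: \<Psi>_def \<mu>_def \<alpha>_def \<beta>_def h k scaleR_add_right sc n add.commute)
  qed
  have "homotopic_with_canon (\<lambda>_. True) \<Sigma> (- {0}) (\<lambda>P. \<Psi> (1, P)) (\<lambda>(\<tau>, z, w). (2 * \<tau>\<^sup>2 - 1, - (\<tau> *\<^sub>R z), z + w))"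
  proof (rule homotopic_punctured_linear)
    fix P r assume P: "P \<in> \<Sigma>" and r: "0 \<le> r" "(r::real) \<le> 1"
    obtain \<tau> z w where Pe: "P = (\<tau>, z, w)" by (cases P)
    define \<zeta> \<omega> where "\<zeta> = norm z" and "\<omega> = norm w"
    note nP = norm\<Sigma>[OF P[unfolded Pe], folded \<zeta>_def \<omega>_def]
    \<comment> \<open>The last component forces \<open>w = - z\<close>; then the middle ones are nonnegative multiples of the same vector, and the first ones agree.\<close>
    have False if
      T: "(1 - r) * (1 - 4 * (\<zeta> * \<omega>)) + r * (2 * \<tau>\<^sup>2 - 1) = 0" and
      A: "(1 - r) *\<^sub>R ((1 + \<tau>) *\<^sub>R \<zeta> *\<^sub>R w + (1 - \<tau>) *\<^sub>R \<omega> *\<^sub>R z) + r *\<^sub>R (- (\<tau> *\<^sub>R z)) = 0" and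
      B: "(1 - r) *\<^sub>R (\<zeta> * \<omega>) *\<^sub>R (z + w) + r *\<^sub>R (z + w) = 0"
    proof -
      have "((1 - r) * (\<zeta> * \<omega>) + r) *\<^sub>R (z + w) = 0" using B by (simp add: scaleR_add_left)
      then consider "(1 - r) * (\<zeta> * \<omega>) + r = 0" | "z + w = 0" by auto
      then show False
      proof cases
        case 1
        have "(1 - r) * (\<zeta> * \<omega>) \<ge> 0" using r by (simp add: \<zeta>_def \<omega>_def)
        then have "r = 0" using 1 r by linarith
        then have "\<zeta> * \<omega> = 0" using 1 by simp
        then show False using T \<open>r = 0\<close> by auto
      next
        case 2
        then have w: "w = - z" by (simp add: eq_neg_iff_add_eq_0 add.commute)
        then have "\<omega> = \<zeta>" by (simp add: \<zeta>_def \<omega>_def)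
        then have \<zeta>2: "4 * (\<zeta> * \<omega>) = 2 - 2 * \<tau>\<^sup>2" using nP by (simp add: power2_eq_square)
        define c where "c = (1 - \<tau>) * \<zeta> - (1 + \<tau>) * \<zeta>"
        have Aw: "(1 + \<tau>) *\<^sub>R \<zeta> *\<^sub>R w + (1 - \<tau>) *\<^sub>R \<omega> *\<^sub>R z = c *\<^sub>R z"
          unfolding c_def w \<open>\<omega> = \<zeta>\<close> scaleR_diff_left scaleR_scaleR scaleR_minus_right by (rule uminus_add_conv_diff)
        have "((1 - r) * c - r * \<tau>) *\<^sub>R z = (1 - r) *\<^sub>R c *\<^sub>R z + r *\<^sub>R (- (\<tau> *\<^sub>R z))"
          by (simp add: scaleR_diff_left)
        then have "((1 - r) * c - r * \<tau>) *\<^sub>R z = 0" using A unfolding Aw by (rule trans)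
        moreover have "(1 - r) * c - r * \<tau> = - (\<tau> * (2 * (1 - r) * \<zeta> + r))"
          by (simp add: c_def algebra_simps)
        ultimately have "(\<tau> * (2 * (1 - r) * \<zeta> + r)) *\<^sub>R z = 0"
          by (simp only: scaleR_minus_left neg_equal_0_iff_equal)
        then consider "\<tau> = 0" | "z = 0" | "2 * (1 - r) * \<zeta> + r = 0" by auto
        then have "\<tau> = 0 \<or> z = 0"
        proof cases
          case 3
          have "(1 - r) * \<zeta> \<ge> 0" using r by (simp add: \<zeta>_def)
          then have "r = 0" using 3 r by linarith
          then have "\<zeta> = 0" using 3 by simp
          then show ?thesis by (simp add: \<zeta>_def)
        qed auto
        moreover have "2 * \<tau>\<^sup>2 - 1 = 0"
        proof -
          have eq: "1 - 4 * (\<zeta> * \<omega>) = 2 * \<tau>\<^sup>2 - 1" using \<zeta>2 by linarith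
          have "2 * \<tau>\<^sup>2 - 1 = (1 - r) * (2 * \<tau>\<^sup>2 - 1) + r * (2 * \<tau>\<^sup>2 - 1)" by (simp add: left_diff_distrib)
          then show ?thesis using T unfolding eq by (rule trans)
        qed
        ultimately show False using nP by (auto simp: \<zeta>_def \<omega>_def w)
      qed
    qed
    then show "(1 - r) *\<^sub>R \<Psi> (1, P) + r *\<^sub>R (case P of (\<tau>, z, w) \<Rightarrow> (2 * \<tau>\<^sup>2 - 1, - (\<tau> *\<^sub>R z), z + w)) \<noteq> 0"
      unfolding Pe end1 prod.case \<zeta>_def \<omega>_def zero_prod_def by (auto simp del: scaleR_minus_right)
  qed (use cont[of 1] in \<open>auto simp: split_beta intro!: continuous_intros\<close>)
  then have L: "homotopic_with_canon (\<lambda>_. True) \<Sigma> (- {0}) (\<lambda>P. \<Psi> (0, P)) (\<lambda>(\<tau>, z, w). (2 * \<tau>\<^sup>2 - 1, - (\<tau> *\<^sub>R z), z + w))"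
    using hom homotopic_with_trans by blast
  show ?thesis
  proof (rule ccontr)
    assume neg: "\<not> thesis"
    have "homotopic_with_canon (\<lambda>_. True) \<Sigma> (- {0}) (\<lambda>P. \<Psi> (0, P)) (\<lambda>_. (1, 0, 0))"
    proof (rule homotopic_punctured_linear)
      fix P r assume P: "P \<in> \<Sigma>" and r: "0 \<le> r" "(r::real) \<le> 1"
      obtain \<tau> z w where Pe: "P = (\<tau>, z, w)" by (cases P)
      show "(1 - r) *\<^sub>R \<Psi> (0, P) + r *\<^sub>R (1, 0, 0) \<noteq> 0"
      proof
        assume 0: "(1 - r) *\<^sub>R \<Psi> (0, P) + r *\<^sub>R (1, 0, 0) = 0"
        then have "r \<noteq> 1" by (auto simp: zero_prod_def)
        then have *: "\<mu> (0, P) *\<^sub>R \<alpha> (0, P) = 0" "\<mu> (0, P) *\<^sub>R \<beta> (0, P) = 0"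
          using 0 by (auto simp: \<Psi>_def zero_prod_def)
        show False
        proof (cases "\<mu> (0, P) = 0")
          case True
          then show False using 0 by (auto simp: \<Psi>_def zero_prod_def)
        next
          case False
          then have "z \<noteq> 0" "w \<noteq> 0" by (auto simp: \<mu>_def Pe)
          moreover have "\<alpha> (0, P) = 0" "\<beta> (0, P) = 0" using * False by auto
          ultimately have "f (sgn z, sgn w) = - sgn w" "g (sgn z, sgn w) = - sgn w"
            using zero[of 0 \<tau> z w] P by (auto simp: Pe h k)
          then show False
            using neg that[of "sgn z" "sgn w"] sgnS \<open>z \<noteq> 0\<close> \<open>w \<noteq> 0\<close> by blast
        qed
      qed
    qed (use cont[of 0] in auto)
    then have "homotopic_with_canon (\<lambda>_. True) \<Sigma> (- {0})
        (\<lambda>(\<tau>, z, w). (2 * \<tau>\<^sup>2 - 1, - (\<tau> *\<^sub>R z), z + w)) (\<lambda>_. (1, 0, 0))"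
      using L homotopic_with_trans homotopic_with_sym by blast
    then show False
      using suspended_double_not_null[OF odd] unfolding \<Sigma>_def by blast
  qed
qed

section \<open>Paths and maps of two variables\<close>

text \<open>The tube lemma, applied to the compact set in a subbasic open set of paths.\<close>
lemma continuous_map_curry:
  fixes Z :: "'b topology"
  assumes cont: "continuous_map (prod_topology A (top_of_set {0..1})) Z (\<lambda>(a, t). s a t)"
    and ext: "\<And>a. a \<in> topspace A \<Longrightarrow> s a \<in> extensional {0..1}"
  shows "continuous_map A (path_space Z) s"
  unfolding path_space_def compact_open_topology_def
proof (rule continuous_on_generated_topo)
  have path: "continuous_map (top_of_set {0..1}) Z (s a)" if "a \<in> topspace A" for a
    using continuous_map_o_Pair[OF cont that] by (simp add: o_def)
  then show "s ` topspace A \<subseteq> \<Union> {{f \<in> extensional (topspace (top_of_set {0..1})). continuous_map (top_of_set {0..1}) Z f \<and> f ` K \<subseteq> U} |K U.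
        compactin (top_of_set {0..1}) K \<and> openin Z U}"
    unfolding topspace_compact_open_topology[unfolded compact_open_topology_def topology_generated_by_topspace]
    using ext by auto
  fix W :: "(real \<Rightarrow> 'b) set" assume "W \<in> {{f \<in> extensional (topspace (top_of_set {0..1})). continuous_map (top_of_set {0..1}) Z f \<and> f ` K \<subseteq> U} |K U.
        compactin (top_of_set {0..1}) K \<and> openin Z U}"
  then obtain K U where K: "compactin (top_of_set {0..1::real}) K" and U: "openin Z U"
    and W: "W = {f \<in> extensional (topspace (top_of_set {0..1})). continuous_map (top_of_set {0..1}) Z f \<and> f ` K \<subseteq> U}"
    by blast
  define V where "V = {x \<in> topspace (prod_topology A (top_of_set {0..1})). (\<lambda>(a, t). s a t) x \<in> U}"
  have V: "openin (prod_topology A (top_of_set {0..1})) V"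
    unfolding V_def using cont U by (rule openin_continuous_map_preimage)
  have K01: "K \<subseteq> {0..1}" using compactin_subset_topspace[OF K] by simp
  show "openin A (s -` W \<inter> topspace A)"
    unfolding openin_subopen[of A "s -` W \<inter> topspace A"]
  proof
    fix a assume a: "a \<in> s -` W \<inter> topspace A"
    then have "{a} \<times> K \<subseteq> V" using K01 by (auto simp: V_def W)
    then obtain B T where "openin A B" "a \<in> B" "K \<subseteq> T" "B \<times> T \<subseteq> V"
      using tube_lemma_right[OF V K, of a] a by blast
    then have B: "openin A B" "a \<in> B" "B \<times> K \<subseteq> V" by auto
    have "B \<subseteq> s -` W \<inter> topspace A"
      using B openin_subset[OF B(1)] path ext by (auto simp: W V_def)
    then show "\<exists>T. openin A T \<and> a \<in> T \<and> T \<subseteq> s -` W \<inter> topspace A" using B by blast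
  qed
qed

text \<open>Evaluation is continuous because the unit interval is locally compact: near \<open>t\<close> a path can be
  tested on a compact interval.\<close>
lemma continuous_map_uncurry:
  assumes s: "continuous_map A (path_space Z) s"
  shows "continuous_map (prod_topology A (top_of_set {0..1})) Z (\<lambda>(a, t). s a t)"
  unfolding continuous_map_def
proof (intro conjI allI impI)
  have path: "continuous_map (top_of_set {0..1}) Z (s a)" if "a \<in> topspace A" for a
    using continuous_map_image_subset_topspace[OF s] that
    by (auto simp: path_space_def topspace_compact_open_topology)
  show "(\<lambda>(a, t). s a t) \<in> topspace (prod_topology A (top_of_set {0..1})) \<rightarrow> topspace Z"
    using continuous_map_image_subset_topspace[OF path] by auto
  fix U assume U: "openin Z U"
  let ?V = "{x \<in> topspace (prod_topology A (top_of_set {0..1})). (case x of (a, t) \<Rightarrow> s a t) \<in> U}"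
  show "openin (prod_topology A (top_of_set {0..1})) ?V"
    unfolding openin_subopen[of _ ?V]
  proof
    fix x assume "x \<in> ?V"
    then obtain a t where x: "x = (a, t)" and a: "a \<in> topspace A" and t: "t \<in> {0..1}" and "s a t \<in> U" by auto
    have "openin (top_of_set {0..1}) {t \<in> topspace (top_of_set {0..1}). s a t \<in> U}"
      using path[OF a] U by (rule openin_continuous_map_preimage)
    then obtain e where e: "e > 0" "\<And>t'. t' \<in> {0..1} \<Longrightarrow> \<bar>t' - t\<bar> < e \<Longrightarrow> s a t' \<in> U"
      using t \<open>s a t \<in> U\<close> unfolding openin_euclidean_subtopology_iff by (auto simp: dist_real_def)
    define K where "K = {0..1} \<inter> cball t (e / 2)"
    have "compact K" unfolding K_def by (intro compact_Int) auto
    then have K: "compactin (top_of_set {0..1}) K" by (auto simp: compactin_subtopology K_def)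
    define B where "B = {a \<in> topspace A. s a \<in> {f \<in> extensional (topspace (top_of_set {0..1})).
        continuous_map (top_of_set {0..1}) Z f \<and> f ` K \<subseteq> U}}"
    have "openin (path_space Z) {f \<in> extensional (topspace (top_of_set {0..1})).
        continuous_map (top_of_set {0..1}) Z f \<and> f ` K \<subseteq> U}"
      unfolding path_space_def compact_open_topology_def
      by (rule topology_generated_by_Basis) (use K U in blast)
    then have B: "openin A B" unfolding B_def by (rule openin_continuous_map_preimage[OF s])
    have "s a \<in> extensional {0..1}"
      using continuous_map_image_subset_topspace[OF s] a by (auto simp: path_space_def topspace_compact_open_topology)
    moreover have "s a ` K \<subseteq> U" using e by (auto simp: K_def dist_real_def abs_minus_commute)
    ultimately have "a \<in> B" using a path by (auto simp: B_def)
    moreover have "openin (top_of_set {0..1}) ({0..1} \<inter> ball t (e / 2))" by (simp add: openin_open_Int)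
    moreover have "B \<times> ({0..1} \<inter> ball t (e / 2)) \<subseteq> ?V" by (auto simp: B_def K_def)
    ultimately show "\<exists>T. openin (prod_topology A (top_of_set {0..1})) T \<and> x \<in> T \<and> T \<subseteq> ?V"
      using B e(1) t by (intro exI[of _ "B \<times> ({0..1} \<inter> ball t (e / 2))"]) (auto simp: openin_prod_Times_iff x)
  qed
qed

section \<open>Extending and cutting off homotopies\<close>

text \<open>The given homotopy, together with \<open>p\<close> at time 0 and \<open>q\<close> at time 1 on all of \<open>K \<inter> U\<close>, is a map on a
  closed subset of \<open>{0..1} \<times> (K \<inter> U)\<close>. It extends to a neighbourhood since the target is an absolute
  neighbourhood retract, and by the tube lemma the neighbourhood contains a product.\<close>
lemma homotopy_extends_to_neighbourhood:
  fixes K :: "'a::euclidean_space set" and h :: "real \<times> 'a \<Rightarrow> 'b::euclidean_space"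
  assumes "ANR S" and p: "continuous_on K p" "p \<in> K \<rightarrow> S" and q: "continuous_on K q" "q \<in> K \<rightarrow> S"
    and C: "closed C" and U: "open U"
    and h: "continuous_on ({0..1} \<times> (K \<inter> C \<inter> U)) h" "h \<in> {0..1} \<times> (K \<inter> C \<inter> U) \<rightarrow> S"
      "\<And>x. x \<in> K \<inter> C \<inter> U \<Longrightarrow> h (0, x) = p x" "\<And>x. x \<in> K \<inter> C \<inter> U \<Longrightarrow> h (1, x) = q x"
  obtains V k where "openin (top_of_set K) V" "K \<inter> C \<inter> U \<subseteq> V"
    "continuous_on ({0..1::real} \<times> V) k" "k \<in> {0..1} \<times> V \<rightarrow> S"
    "\<And>x. x \<in> V \<Longrightarrow> k (0, x) = p x" "\<And>x. x \<in> V \<Longrightarrow> k (1, x) = q x"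
proof -
  define A where "A = {0..1::real} \<times> (K \<inter> C \<inter> U)"
  define B where "B = {0, 1::real} \<times> (K \<inter> U)"
  define F where "F = (\<lambda>y. if snd y \<in> C then h y else if fst y \<le> 1/2 then p (snd y) else q (snd y))"
  have AB: "closedin (top_of_set (A \<union> B)) A" "closedin (top_of_set (A \<union> B)) B"
    "closedin (top_of_set ({0..1} \<times> (K \<inter> U))) (A \<union> B)"
  proof -
    have "closed (UNIV \<times> C :: (real \<times> 'a) set)" "closed ({0, 1::real} \<times> (UNIV :: 'a set))"
      using C by (auto intro!: closed_Times)
    moreover have "A = (A \<union> B) \<inter> (UNIV \<times> C)" "B = (A \<union> B) \<inter> ({0, 1} \<times> UNIV)"
      "A \<union> B = ({0..1} \<times> (K \<inter> U)) \<inter> (UNIV \<times> C \<union> {0, 1} \<times> UNIV)"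
      by (auto simp: A_def B_def)
    ultimately show "closedin (top_of_set (A \<union> B)) A" "closedin (top_of_set (A \<union> B)) B"
      "closedin (top_of_set ({0..1} \<times> (K \<inter> U))) (A \<union> B)"
      by (metis closedin_closed_Int closed_Un)+
  qed
  have "continuous_on (A \<union> B) F"
    unfolding F_def
  proof (rule continuous_on_cases_local[OF AB(1,2)])
    show "continuous_on A h" using h(1) by (simp add: A_def)
    show "continuous_on B (\<lambda>y. if fst y \<le> 1/2 then p (snd y) else q (snd y))"
    proof (rule continuous_on_cases_le)
      show "continuous_on {x \<in> B. fst x \<le> 1/2} (\<lambda>y. p (snd y))" "continuous_on {x \<in> B. 1/2 \<le> fst x} (\<lambda>y. q (snd y))"
        by (intro continuous_on_compose2[OF p(1)] continuous_on_compose2[OF q(1)] continuous_intros; auto simp: B_def)+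
    qed (auto simp: B_def intro!: continuous_intros)
    show "h x = (if fst x \<le> 1/2 then p (snd x) else q (snd x))"
      if "x \<in> A \<and> snd x \<notin> C \<or> x \<in> B \<and> snd x \<in> C" for x
      using that h(3,4) by (cases x) (auto simp: A_def B_def)
  qed
  moreover have "F \<in> A \<union> B \<rightarrow> S"
    using h(2) p(2) q(2) by (auto simp: F_def A_def B_def Pi_iff)
  ultimately obtain N k where N: "A \<union> B \<subseteq> N" "openin (top_of_set ({0..1} \<times> (K \<inter> U))) N"
    "continuous_on N k" "k \<in> N \<rightarrow> S" "\<And>y. y \<in> A \<union> B \<Longrightarrow> k y = F y"
    using ANR_imp_absolute_neighbourhood_extensor[OF \<open>ANR S\<close> _ _ AB(3)] by metis
  obtain V where V: "openin (top_of_set (K \<inter> U)) V" "K \<inter> C \<inter> U \<subseteq> V" "{0..1} \<times> V \<subseteq> N"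
    using tube_lemma_gen[of "{0..1::real}" "K \<inter> C \<inter> U" "K \<inter> U" N] N(1,2) by (auto simp: A_def)
  have VU: "V \<subseteq> K \<inter> U" using V(1) openin_imp_subset by blast
  show thesis
  proof (rule that[of V k])
    show "openin (top_of_set K) V" using V(1) U openin_trans openin_open_Int by blast
    show "continuous_on ({0..1} \<times> V) k" "k \<in> {0..1} \<times> V \<rightarrow> S"
      using continuous_on_subset[OF N(3) V(3)] N(4) V(3) by auto
    show "k (0, x) = p x" "k (1, x) = q x" if "x \<in> V" for x
    proof -
      have "(0, x) \<in> B" "(1, x) \<in> B" using that VU by (auto simp: B_def)
      then show "k (0, x) = p x" "k (1, x) = q x"
        using N(5)[of "(0, x)"] N(5)[of "(1, x)"] h(3,4) VU that by (auto simp: F_def)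
    qed
  qed (rule V(2))
qed

text \<open>The homotopy \<open>k\<close> is run only for a time that depends on the point: a Urysohn function makes
  this time 1 on \<open>A\<close> and 0 near the complement of \<open>V\<close>.\<close>
lemma homotopy_cutoff:
  fixes K :: "'a::euclidean_space set"
  assumes p: "continuous_on K p" "p \<in> K \<rightarrow> S"
    and V: "openin (top_of_set K) V" and A: "closedin (top_of_set K) A" "A \<subseteq> V"
    and k: "continuous_on ({0..1::real} \<times> V) k" "k \<in> {0..1} \<times> V \<rightarrow> S"
    "\<And>x. x \<in> V \<Longrightarrow> k (0, x) = p x" "\<And>x. x \<in> V \<Longrightarrow> k (1, x) = q x"
  obtains f where "homotopic_with_canon (\<lambda>_. True) K S f p" "\<And>x. x \<in> A \<Longrightarrow> f x = q x"
proof -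
  have "closedin (top_of_set K) (K - V)" using closedin_diff[OF closedin_topspace V] by simp
  moreover have "(K - V) \<inter> A = {}" using A(2) by blast
  ultimately obtain u where u: "continuous_on K u" "\<And>x. x \<in> K \<Longrightarrow> u x \<in> closed_segment 0 (1::real)"
      "\<And>x. x \<in> K - V \<Longrightarrow> u x = 0" "\<And>x. x \<in> A \<Longrightarrow> u x = 1"
    using Urysohn_local[OF _ A(1), of "K - V" 0 1] by blast
  have u01: "0 \<le> u x" "u x \<le> 1" if "x \<in> K" for x using u(2)[OF that] by (auto simp: closed_segment_eq_real_ivl)
  \<comment> \<open>The time is 0 already for \<open>u \<le> 1/2\<close>, so \<open>k\<close> is only evaluated on a closed part of \<open>V\<close>.\<close>
  define H where "H = (\<lambda>y. if u (snd y) \<le> 1/2 then p (snd y) else k (fst y * (2 * u (snd y) - 1), snd y))"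
  have inV: "x \<in> V" if "x \<in> K" "1/2 \<le> u x" for x using u(3)[of x] that by (cases "x \<in> V") auto
  have range: "t * (2 * u x - 1) \<in> {0..1}" if "x \<in> K" "1/2 \<le> u x" "t \<in> {0..1}" for x t
    using u01[OF that(1)] that by (auto intro: mult_le_one)
  have "continuous_on ({0..1} \<times> K) H"
    unfolding H_def
  proof (rule continuous_on_cases_le)
    show "continuous_on {x \<in> {0..1} \<times> K. u (snd x) \<le> 1/2} (\<lambda>x. p (snd x))"
      by (intro continuous_on_compose2[OF p(1)] continuous_intros) auto
    show "continuous_on {x \<in> {0..1} \<times> K. 1/2 \<le> u (snd x)} (\<lambda>x. k (fst x * (2 * u (snd x) - 1), snd x))"
      by (intro continuous_on_compose2[OF k(1)] continuous_intros continuous_on_compose2[OF u(1)])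
         (use inV range in auto)
    show "continuous_on ({0..1} \<times> K) (\<lambda>x. u (snd x))"
      by (intro continuous_on_compose2[OF u(1)] continuous_intros) auto
    show "p (snd x) = k (fst x * (2 * u (snd x) - 1), snd x)" if "x \<in> {0..1} \<times> K" "u (snd x) = 1/2" for x
    proof -
      have "2 * u (snd x) - 1 = 0" "snd x \<in> V" using that inV[of "snd x"] by auto
      then show ?thesis using k(3)[of "snd x"] by (simp only: mult_zero_right)
    qed
  qed
  moreover have "H (t, x) \<in> S" if "t \<in> {0..1}" "x \<in> K" for t x
    using p(2) funcset_mem[OF k(2), of "(t * (2 * u x - 1), x)"] range[of x t] inV[of x] that
    by (auto simp: H_def)
  moreover have "H (0, x) = p x" if "x \<in> K" for x
    using inV[of x] k(3)[of x] that by (auto simp: H_def)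
  ultimately have "homotopic_with_canon (\<lambda>_. True) K S p (\<lambda>x. H (1, x))"
    by (intro homotopic_canonI) auto
  moreover have "H (1, x) = q x" if "x \<in> A" for x
    using that A u(4)[of x] k(4)[of x] by (auto simp: H_def)
  ultimately show thesis using that homotopic_with_sym by blast
qed

section \<open>Lower bound for the topological complexity\<close>

text \<open>The sphere is a retract of the configuration space: \<open>a\<close> corresponds to the pair \<open>(a, 0)\<close>,
  and a pair is sent to the direction of its difference.\<close>
definition with_origin :: "('a::euclidean_space \<times> 'a) \<Rightarrow> ('a \<times> 'a) \<times> ('a \<times> 'a)" where
  "with_origin = (\<lambda>(a, c). ((a, 0), (c, 0)))"

lemma sphere_homotopy_from_planning_rule:
  fixes E :: "(('a::euclidean_space \<times> 'a) \<times> ('a \<times> 'a)) set"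
  defines "S \<equiv> sphere (0::'a) 1"
  assumes s: "motion_planning_rule (top_of_set (conf2 UNIV)) E s" and E: "E \<subseteq> conf2 UNIV \<times> conf2 UNIV"
  shows "\<exists>h. continuous_on ({0..1::real} \<times> (S \<times> S \<inter> with_origin -` E)) h \<and>
    h \<in> {0..1} \<times> (S \<times> S \<inter> with_origin -` E) \<rightarrow> S \<and>
    (\<forall>x \<in> S \<times> S \<inter> with_origin -` E. h (0, x) = fst x \<and> h (1, x) = snd x)"
proof -
  have ES: "subtopology (prod_topology (top_of_set (conf2 UNIV)) (top_of_set (conf2 UNIV))) E = top_of_set E"
    using E by (simp add: subtopology_subtopology inf.absorb2)
  have cont: "continuous_map (top_of_set (E \<times> {0..1})) (top_of_set (conf2 UNIV)) (\<lambda>(x, t). s x t)"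
    using s continuous_map_uncurry[of "top_of_set E" "top_of_set (conf2 UNIV)" s]
    unfolding motion_planning_rule_def ES by simp
  have paths: "s (x, y) 0 = x" "s (x, y) 1 = y" if "(x, y) \<in> E" for x y
    using s that by (auto simp: motion_planning_rule_def paths_between_def)
  define h where "h = (\<lambda>y. let v = s (with_origin (snd y)) (fst y) in sgn (fst v - snd v))"
  have mem: "s (with_origin x) t \<in> conf2 UNIV" if "t \<in> {0..1}" "with_origin x \<in> E" for x t
    using funcset_mem[OF continuous_map_funspace[OF cont], of "(with_origin x, t)"] that by auto
  show ?thesis
  proof (intro exI[of _ h] conjI ballI)
    let ?D = "{0..1::real} \<times> (S \<times> S \<inter> with_origin -` E)"
    have "continuous_on (E \<times> {0..1}) (\<lambda>(x, t). s x t)" using cont by simp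
    moreover have "continuous_on ?D (\<lambda>y. (with_origin (snd y), fst y))"
      unfolding with_origin_def split_beta by (intro continuous_intros)
    ultimately have "continuous_on ?D (\<lambda>y. (\<lambda>(x, t). s x t) (with_origin (snd y), fst y))"
      by (rule continuous_on_compose2) auto
    then have "continuous_on ?D (\<lambda>y. s (with_origin (snd y)) (fst y))" by simp
    moreover have "fst (s (with_origin (snd y)) (fst y)) - snd (s (with_origin (snd y)) (fst y)) \<noteq> 0"
      if "y \<in> ?D" for y
      using mem[of "fst y" "snd y"] that by (simp add: mem_Times_iff conf2_def split_beta)
    ultimately show "continuous_on ?D h"
      unfolding h_def Let_def by (intro continuous_on_sgn continuous_intros) blast+
    show "h \<in> ?D \<rightarrow> S"
    proof (rule funcsetI)
      fix y assume "y \<in> ?D"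
      then have "s (with_origin (snd y)) (fst y) \<in> conf2 UNIV" using mem by (simp add: mem_Times_iff)
      then show "h y \<in> S" by (simp add: h_def Let_def S_def norm_sgn conf2_def split_beta)
    qed
    show "h (0, x) = fst x" "h (1, x) = snd x" if "x \<in> S \<times> S \<inter> with_origin -` E" for x
      using that paths by (auto simp: h_def with_origin_def S_def sgn_div_norm)
  qed
qed

lemma closed_pieces_of_open_cover:
  fixes K :: "'a::euclidean_space set"
  assumes "openin (top_of_set K) U" "openin (top_of_set K) V" "U \<union> V = K"
  obtains A B where "closedin (top_of_set K) A" "closedin (top_of_set K) B" "A \<subseteq> U" "B \<subseteq> V" "A \<union> B = K"
proof -
  have "closedin (top_of_set K) (K - U)" "closedin (top_of_set K) (K - V)" "(K - U) \<inter> (K - V) = {}"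
    using closedin_diff[OF closedin_topspace assms(1)] closedin_diff[OF closedin_topspace assms(2)] assms(3) by auto
  then obtain u where u: "continuous_on K u" "\<And>x. x \<in> K \<Longrightarrow> u x \<in> closed_segment 0 (1::real)"
      "\<And>x. x \<in> K - U \<Longrightarrow> u x = 0" "\<And>x. x \<in> K - V \<Longrightarrow> u x = 1"
    by (rule Urysohn_local[where a = 0 and b = 1]) (rule that, assumption, blast+)
  show thesis
  proof (rule that[of "K \<inter> u -` {1/2..}" "K \<inter> u -` {..1/2}"])
    show "closedin (top_of_set K) (K \<inter> u -` {1/2..})" "closedin (top_of_set K) (K \<inter> u -` {..1/2})"
      using u(1) by (auto intro: continuous_closedin_preimage)
    show "K \<inter> u -` {1/2..} \<subseteq> U"
    proof
      fix x assume "x \<in> K \<inter> u -` {1/2..}" then show "x \<in> U" using u(3)[of x] by (cases "x \<in> U") auto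
    qed
    show "K \<inter> u -` {..1/2} \<subseteq> V"
    proof
      fix x assume "x \<in> K \<inter> u -` {..1/2}" then show "x \<in> V" using u(4)[of x] by (cases "x \<in> V") auto
    qed
  qed auto
qed

text \<open>Fixing the end point, the rule contracts the sphere to that point.\<close>
lemma no_global_planning_rule:
  assumes "motion_planning_rule (top_of_set (conf2 (UNIV :: 'a::euclidean_space set))) E s"
  shows "E \<noteq> conf2 UNIV \<times> conf2 UNIV"
proof
  assume E: "E = conf2 UNIV \<times> conf2 UNIV"
  define S where "S = sphere (0::'a) 1"
  have eq: "S \<times> S \<inter> with_origin -` E = S \<times> S"
    by (auto simp: E with_origin_def conf2_def S_def)
  obtain h where h: "continuous_on ({0..1::real} \<times> (S \<times> S)) h" "h \<in> {0..1} \<times> (S \<times> S) \<rightarrow> S"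
    "\<forall>x \<in> S \<times> S. h (0, x) = fst x \<and> h (1, x) = snd x"
    using sphere_homotopy_from_planning_rule[OF assms equalityD1[OF E], folded S_def, unfolded eq]
    by (elim exE conjE) (rule that)
  obtain c :: 'a where "norm c = 1" by (rule vector_choose_size[of 1]) auto
  then have c: "c \<in> S" by (simp add: S_def)
  have "homotopic_with_canon (\<lambda>_. True) S S id (\<lambda>_. c)"
  proof (rule homotopic_canonI)
    show "continuous_on ({0..1} \<times> S) (\<lambda>y. h (fst y, (snd y, c)))"
      by (intro continuous_on_compose2[OF h(1)] continuous_intros) (use c in auto)
  qed (use h(2,3) c in auto)
  then show False
    using contractible_sphere[of "0::'a" 1] unfolding contractible_def S_def by auto
qed

lemma locally_closed_if_locally_compact:
  fixes E :: "'a::metric_space set"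
  assumes "locally_compact_space (top_of_set E)"
  obtains C U where "closed C" "open U" "E = C \<inter> U"
proof -
  have "\<exists>C U. closedin euclidean C \<and> openin euclidean U \<and> C \<inter> U = E"
    by (rule locally_compact_subspace_closed_Int_openin) (simp add: assms Hausdorff_space_euclidean)
  then obtain C U where "closed C" "open U" "E = C \<inter> U" by auto
  then show thesis by (rule that)
qed

text \<open>The rules produce maps \<open>f\<close> and \<open>g\<close> on pairs of unit vectors, homotopic to the first projection, such that
  every pair \<open>(a, c)\<close> satisfies \<open>f (a, c) = c\<close> or \<open>g (a, c) = c\<close>. So they never take the value \<open>- c\<close>
  simultaneously.\<close>
lemma no_two_planning_rules:
  assumes odd: "odd DIM('a::euclidean_space)"
    and part: "locally_compact_partition
        (prod_topology (top_of_set (conf2 (UNIV::'a set))) (top_of_set (conf2 UNIV))) 1 E"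
    and rules: "\<And>i. i \<le> 1 \<Longrightarrow> \<exists>s. motion_planning_rule (top_of_set (conf2 (UNIV::'a set))) (E i) s"
  shows False
proof -
  define S where "S = sphere (0::'a) 1"
  define p q where "p = (fst :: 'a \<times> 'a \<Rightarrow> 'a)" and "q = (snd :: 'a \<times> 'a \<Rightarrow> 'a)"
  have Un: "(\<Union>i\<le>1. E i) = conf2 UNIV \<times> conf2 UNIV"
    using part by (simp add: locally_compact_partition_def)
  have p: "continuous_on (S \<times> S) p" "p \<in> S \<times> S \<rightarrow> S" and q: "continuous_on (S \<times> S) q" "q \<in> S \<times> S \<rightarrow> S"
    by (auto simp: p_def q_def intro!: continuous_intros)
  have ext: "\<exists>V k. openin (top_of_set (S \<times> S)) V \<and> S \<times> S \<inter> with_origin -` E i \<subseteq> V \<and>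
      continuous_on ({0..1::real} \<times> V) k \<and> k \<in> {0..1} \<times> V \<rightarrow> S \<and>
      (\<forall>x\<in>V. k (0, x) = p x) \<and> (\<forall>x\<in>V. k (1, x) = q x)" if i: "i \<le> 1" for i
  proof -
    have Ei: "E i \<subseteq> conf2 UNIV \<times> conf2 UNIV" using Un i by blast
    have "locally_compact_space (subtopology (prod_topology (top_of_set (conf2 UNIV)) (top_of_set (conf2 UNIV))) (E i))"
      using part i unfolding locally_compact_partition_def by blast
    then have "locally_compact_space (top_of_set (E i))"
      by (simp add: subtopology_subtopology Int_absorb1[OF Ei])
    then obtain C U where CU: "closed C" "open U" "E i = C \<inter> U"
      by (rule locally_closed_if_locally_compact)
    have cont: "continuous_on UNIV (with_origin :: 'a \<times> 'a \<Rightarrow> _)"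
      unfolding with_origin_def split_beta by (intro continuous_intros)
    let ?C = "with_origin -` C" and ?U = "with_origin -` U"
    have eq: "S \<times> S \<inter> with_origin -` E i = S \<times> S \<inter> ?C \<inter> ?U" by (auto simp: CU)
    have C: "closed ?C" "open ?U" using cont CU by (auto intro: closed_vimage open_vimage)
    obtain s where s: "motion_planning_rule (top_of_set (conf2 (UNIV::'a set))) (E i) s" using rules i by blast
    obtain h where h: "continuous_on ({0..1::real} \<times> (S \<times> S \<inter> ?C \<inter> ?U)) h"
      "h \<in> {0..1} \<times> (S \<times> S \<inter> ?C \<inter> ?U) \<rightarrow> S"
      "\<forall>x \<in> S \<times> S \<inter> ?C \<inter> ?U. h (0, x) = p x \<and> h (1, x) = q x"
      using sphere_homotopy_from_planning_rule[OF s Ei, folded S_def p_def q_def, unfolded eq]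
      by (elim exE conjE) (rule that)
    then have h01: "\<And>x. x \<in> S \<times> S \<inter> ?C \<inter> ?U \<Longrightarrow> h (0, x) = p x"
      "\<And>x. x \<in> S \<times> S \<inter> ?C \<inter> ?U \<Longrightarrow> h (1, x) = q x" by blast+
    have "ANR S" unfolding S_def by (rule ANR_sphere)
    from homotopy_extends_to_neighbourhood[OF this p q C h(1,2) h01] show ?thesis unfolding eq by metis
  qed
  obtain V0 k0 where V0: "openin (top_of_set (S \<times> S)) V0" "S \<times> S \<inter> with_origin -` E 0 \<subseteq> V0"
    "continuous_on ({0..1::real} \<times> V0) k0" "k0 \<in> {0..1} \<times> V0 \<rightarrow> S"
    "\<And>x. x \<in> V0 \<Longrightarrow> k0 (0, x) = p x" "\<And>x. x \<in> V0 \<Longrightarrow> k0 (1, x) = q x"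
    using ext[of 0] by auto
  obtain V1 k1 where V1: "openin (top_of_set (S \<times> S)) V1" "S \<times> S \<inter> with_origin -` E 1 \<subseteq> V1"
    "continuous_on ({0..1::real} \<times> V1) k1" "k1 \<in> {0..1} \<times> V1 \<rightarrow> S"
    "\<And>x. x \<in> V1 \<Longrightarrow> k1 (0, x) = p x" "\<And>x. x \<in> V1 \<Longrightarrow> k1 (1, x) = q x"
    using ext[of 1] by auto
  have "V0 \<union> V1 = S \<times> S"
  proof
    show "V0 \<union> V1 \<subseteq> S \<times> S" using V0(1) V1(1) openin_imp_subset by blast
    show "S \<times> S \<subseteq> V0 \<union> V1"
    proof
      fix x assume x: "x \<in> S \<times> S"
      then have "with_origin x \<in> conf2 UNIV \<times> conf2 UNIV"
        by (auto simp: with_origin_def conf2_def S_def)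
      then obtain i where "i \<le> 1" "with_origin x \<in> E i" unfolding Un[symmetric] by blast
      then show "x \<in> V0 \<union> V1" using V0(2) V1(2) x by (cases i) auto
    qed
  qed
  with V0(1) V1(1) obtain A B where AB: "closedin (top_of_set (S \<times> S)) A" "closedin (top_of_set (S \<times> S)) B"
    "A \<subseteq> V0" "B \<subseteq> V1" "A \<union> B = S \<times> S"
    by (rule closed_pieces_of_open_cover)
  obtain f where f: "homotopic_with_canon (\<lambda>_. True) (S \<times> S) S f p" "\<And>x. x \<in> A \<Longrightarrow> f x = q x"
    using homotopy_cutoff[OF p V0(1) AB(1,3) V0(3-6)] by blast
  obtain g where g: "homotopic_with_canon (\<lambda>_. True) (S \<times> S) S g p" "\<And>x. x \<in> B \<Longrightarrow> g x = q x"
    using homotopy_cutoff[OF p V1(1) AB(2,4) V1(3-6)] by blast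
  obtain a c where ac: "a \<in> S" "c \<in> S" "f (a, c) = - c" "g (a, c) = - c"
    using homotopic_to_fst_common_antipode[OF odd f(1)[unfolded p_def S_def] g(1)[unfolded p_def S_def]]
    unfolding S_def by blast
  have "(a, c) \<in> A \<or> (a, c) \<in> B" using AB(5) ac by blast
  then have "- c = c" using f(2) g(2) ac by (auto simp: q_def)
  then have "2 *\<^sub>R c = 0" by (metis scaleR_2 add.right_inverse)
  then have "c = 0" by simp
  then show False using ac by (simp add: S_def)
qed

theorem TC_conf2_lower_bound:
  "TC (top_of_set (conf2 (UNIV :: 'a::euclidean_space set))) \<ge> (if even DIM('a) then 1 else 2)"
  unfolding TC_def
proof (rule Inf_greatest, clarify)
  fix k E
  assume part: "locally_compact_partition (prod_topology (top_of_set (conf2 (UNIV::'a set))) (top_of_set (conf2 UNIV))) k E"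
    and rules: "\<forall>i\<le>k. \<exists>s. motion_planning_rule (top_of_set (conf2 (UNIV::'a set))) (E i) s"
  have "k \<noteq> 0"
  proof
    assume k: "k = 0"
    then have "E 0 = conf2 UNIV \<times> conf2 UNIV" using part by (simp add: locally_compact_partition_def)
    then show False using no_global_planning_rule rules k by blast
  qed
  moreover have "k \<noteq> 1" if "odd DIM('a)"
    using no_two_planning_rules[OF that] part rules by blast
  ultimately have "(if even DIM('a) then 1 else 2) \<le> k" by auto
  then show "(if even DIM('a) then 1 else 2) \<le> enat k"
    by (auto simp: one_enat_def numeral_eq_enat split: if_splits)
qed

section \<open>Topological complexity bounds geodesic complexity from below\<close>

text \<open>A near-geodesic at parameter 1 is a path in \<open>X\<close> itself and not only in its closure, and evaluation at
  1 is continuous, as one sees by viewing paths as maps of two variables.\<close>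
theorem TC_le_GC: "TC (top_of_set X) \<le> GC (X :: 'a::complete_space set)"
  unfolding GC_def
proof (rule Inf_greatest, clarify)
  fix k E
  assume part: "locally_compact_partition (prod_topology (top_of_set X) (top_of_set X)) k E"
    and rules: "\<forall>i\<le>k. \<exists>\<Phi>. NGMPR X (E i) \<Phi>"
  have "\<exists>s. motion_planning_rule (top_of_set X) (E i) s" if i: "i \<le> k" for i
  proof -
    obtain \<Phi> where \<Phi>: "NGMPR X (E i) \<Phi>" using rules i by blast
    define A where "A = subtopology (prod_topology (top_of_set X) (top_of_set X)) (E i)"
    have sub: "E i \<subseteq> X \<times> X" using part i by (auto simp: locally_compact_partition_def)
    then have A: "topspace A = E i" by (auto simp: A_def)
    have ends: "\<Phi> x 1 \<in> paths_between (top_of_set X) (fst x) (snd x)" if "x \<in> E i" for x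
    proof -
      have "near_geodesic X (fst x) (snd x) (\<Phi> x)"
        using \<Phi> that unfolding NGMPR_def by (cases x) auto
      moreover have "(1::real) \<in> {0<..1}" by simp
      ultimately show ?thesis unfolding near_geodesic_def by blast
    qed
    have "continuous_map A (path_space (path_space (top_of_set (closure X)))) \<Phi>"
      using \<Phi> by (simp add: NGMPR_def A_def)
    then have "continuous_map (prod_topology A (top_of_set {0..1})) (path_space (top_of_set (closure X))) (\<lambda>(a, s). \<Phi> a s)"
      by (rule continuous_map_uncurry)
    moreover have "continuous_map A (prod_topology A (top_of_set {0..1})) (\<lambda>a. (a, 1::real))"
      by (simp add: continuous_map_pairwise o_def)
    ultimately have "continuous_map A (path_space (top_of_set (closure X))) ((\<lambda>(a, s). \<Phi> a s) \<circ> (\<lambda>a. (a, 1)))"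
      by (intro continuous_map_compose)
    then have "continuous_map A (path_space (top_of_set (closure X))) (\<lambda>a. \<Phi> a 1)"
      by (simp add: o_def)
    then have "continuous_map (prod_topology A (top_of_set {0..1})) (top_of_set (closure X)) (\<lambda>(a, t). \<Phi> a 1 t)"
      by (rule continuous_map_uncurry)
    moreover have "\<Phi> a 1 t \<in> X" if "a \<in> E i" "t \<in> {0..1}" for a t
      using ends[OF that(1)] that(2)
      by (auto simp: paths_between_def path_space_def topspace_compact_open_topology)
    ultimately have "continuous_map (prod_topology A (top_of_set {0..1})) (top_of_set X) (\<lambda>(a, t). \<Phi> a 1 t)"
      by (auto simp: continuous_map_in_subtopology A)
    then have "continuous_map A (path_space (top_of_set X)) (\<lambda>a. \<Phi> a 1)"
      using ends by (intro continuous_map_curry)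
        (auto simp: A paths_between_def path_space_def topspace_compact_open_topology)
    then have "motion_planning_rule (top_of_set X) (E i) (\<lambda>a. \<Phi> a 1)"
      unfolding motion_planning_rule_def A_def using ends by auto
    then show ?thesis by blast
  qed
  then show "TC (top_of_set X) \<le> enat k"
    unfolding TC_def using part by (intro Inf_lower) blast
qed

section \<open>Lengths and geodesics in Euclidean space\<close>

lemma length_of_path_ge: "ennreal (dist (\<gamma> 0) (\<gamma> 1)) \<le> length_of_path \<gamma>"
  unfolding length_of_path_def by (rule SUP_upper2[of "[0, 1]"]) auto

lemma length_of_path_le:
  assumes "L \<ge> 0" and lip: "\<And>t t'. t \<in> {0..1} \<Longrightarrow> t' \<in> {0..1} \<Longrightarrow> dist (\<gamma> t) (\<gamma> t') \<le> L * \<bar>t - t'\<bar>"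
  shows "length_of_path \<gamma> \<le> ennreal L"
  unfolding length_of_path_def
proof (rule SUP_least, clarify)
  fix ts :: "real list" assume ts: "ts \<noteq> []" "sorted ts" "set ts \<subseteq> {0..1}"
  define n where "n = length ts - 1"
  have len: "length ts = Suc n" using ts(1) by (simp add: n_def)
  have mem: "ts ! i \<in> {0..1}" if "i \<le> n" for i by (rule subsetD[OF ts(3)]) (simp add: len that less_Suc_eq_le)
  have "(\<Sum>i<n. ennreal (dist (\<gamma> (ts ! i)) (\<gamma> (ts ! Suc i)))) \<le> (\<Sum>i<n. ennreal (L * (ts ! Suc i - ts ! i)))"
  proof (intro sum_mono ennreal_leI)
    fix i assume "i \<in> {..<n}"
    then have "ts ! i \<le> ts ! Suc i" using ts(2) len by (intro sorted_nth_mono) auto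
    then show "dist (\<gamma> (ts ! i)) (\<gamma> (ts ! Suc i)) \<le> L * (ts ! Suc i - ts ! i)"
      using lip[of "ts ! i" "ts ! Suc i"] mem[of i] mem[of "Suc i"] \<open>i \<in> {..<n}\<close> by simp
  qed
  also have "\<dots> = ennreal (\<Sum>i<n. L * (ts ! Suc i - ts ! i))"
    using ts(2) len assms(1) by (intro sum_ennreal mult_nonneg_nonneg) (auto intro: sorted_nth_mono)
  also have "(\<Sum>i<n. L * (ts ! Suc i - ts ! i)) = L * (ts ! n - ts ! 0)"
    by (simp add: sum_lessThan_telescope flip: sum_distrib_left)
  also have "ennreal (L * (ts ! n - ts ! 0)) \<le> ennreal L"
    using mem[of n] mem[of 0] assms(1) by (intro ennreal_leI mult_left_le) auto
  finally show "(\<Sum>i<length ts - 1. ennreal (dist (\<gamma> (ts ! i)) (\<gamma> (ts ! Suc i)))) \<le> ennreal L"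
    by (simp add: n_def)
qed

text \<open>Equality in the triangle inequality forces the points of a geodesic onto the segment. So if the
  configuration space contains a geodesic between two of its points, it contains the straight
  line that the planning rules start from.\<close>
lemma geodesic_eq_linepath:
  fixes x y :: "'a::euclidean_space"
  assumes "geodesic Z x y \<gamma>" "t \<in> {0..1}"
  shows "\<gamma> t = linepath x y t"
proof -
  have ends: "\<gamma> 0 = x" "\<gamma> 1 = y" using assms(1) by (auto simp: geodesic_def paths_between_def)
  have d: "dist (\<gamma> 0) (\<gamma> t) = t * dist x y" "dist (\<gamma> t) (\<gamma> 1) = (1 - t) * dist x y"
    using assms unfolding geodesic_def by (force simp: abs_if)+
  then have n: "norm (x - \<gamma> t) = t * dist x y" "norm (\<gamma> t - y) = (1 - t) * dist x y"
    by (simp_all add: ends dist_norm)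
  show ?thesis
  proof (cases "x = y")
    case True
    then show ?thesis using n by (simp add: linepath_def flip: scaleR_add_left)
  next
    case False
    have "dist x y = dist x (\<gamma> t) + dist (\<gamma> t) y"
      using d by (simp add: ends left_diff_distrib)
    then have "norm (x - \<gamma> t) *\<^sub>R (\<gamma> t - y) = norm (\<gamma> t - y) *\<^sub>R (x - \<gamma> t)"
      by (simp only: dist_triangle_eq)
    then have "dist x y *\<^sub>R (t *\<^sub>R (\<gamma> t - y)) = dist x y *\<^sub>R ((1 - t) *\<^sub>R (x - \<gamma> t))"
      by (simp add: n mult.commute)
    then have "t *\<^sub>R (\<gamma> t - y) = (1 - t) *\<^sub>R (x - \<gamma> t)"
      using False by (simp only: scaleR_cancel_left dist_eq_0_iff simp_thms)
    then show ?thesis by (simp add: linepath_def algebra_simps)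
  qed
qed

section \<open>Bent lines as near-geodesics\<close>

text \<open>Only the first point of the configuration is pushed aside, in the direction \<open>v\<close>; this suffices because
  only the difference of the two points matters. The factor \<open>t * (1 - t)\<close> keeps the end points fixed.
  Restricting to the unit interval gives elements of the path space.\<close>
definition bent_line :: "'a::real_vector \<times> 'a \<Rightarrow> 'a \<times> 'a \<Rightarrow> 'a \<Rightarrow> real \<Rightarrow> real \<Rightarrow> 'a \<times> 'a" where
  "bent_line x y v = (\<lambda>s\<in>{0..1}. \<lambda>t\<in>{0..1}. (1 - t) *\<^sub>R x + t *\<^sub>R y + (s * (t * (1 - t))) *\<^sub>R (v, 0))"

text \<open>Together with the length bounds, this Lipschitz constant makes the lengths converge to the length
  of the line as \<open>s\<close> tends to 0.\<close>
lemma dist_bent_line_le: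
  fixes x y :: "'a::real_normed_vector \<times> 'a"
  assumes "s \<in> {0..1}" "t \<in> {0..1}" "t' \<in> {0..1}"
  shows "dist (bent_line x y v s t) (bent_line x y v s t') \<le> (dist x y + s * norm v) * \<bar>t - t'\<bar>"
proof -
  have "bent_line x y v s t - bent_line x y v s t' = (t - t') *\<^sub>R (y - x) + ((t - t') * (s * (1 - t - t'))) *\<^sub>R (v, 0)"
    using assms by (simp add: bent_line_def algebra_simps)
  also have "norm \<dots> \<le> norm ((t - t') *\<^sub>R (y - x)) + norm (((t - t') * (s * (1 - t - t'))) *\<^sub>R (v, 0 :: 'a))"
    by (rule norm_triangle_ineq)
  also have "\<dots> = \<bar>t - t'\<bar> * (dist x y + s * (\<bar>1 - t - t'\<bar> * norm v))"
    using assms by (simp add: norm_Pair dist_norm norm_minus_commute abs_mult distrib_left mult_ac)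
  also have "\<dots> \<le> \<bar>t - t'\<bar> * (dist x y + s * (1 * norm v))"
    using assms by (intro mult_left_mono add_mono mult_right_mono) auto
  finally show ?thesis by (simp add: dist_norm mult.commute)
qed

text \<open>Convergence of the lengths holds for all bent lines, and by lemma \<open>geodesic_eq_linepath\<close> so does the
  proviso about geodesics in the space itself. It remains to avoid collisions for \<open>s > 0\<close>.\<close>
lemma NGMPR_bent_lines:
  fixes E :: "(('a::euclidean_space \<times> 'a) \<times> ('a \<times> 'a)) set"
  assumes E: "E \<subseteq> conf2 UNIV \<times> conf2 UNIV" and v: "continuous_on E v"
    and avoid: "\<And>a b a' b' s t. ((a, b), (a', b')) \<in> E \<Longrightarrow> s \<in> {0<..1} \<Longrightarrow> t \<in> {0..1} \<Longrightarrow>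
      (1 - t) *\<^sub>R (a - b) + t *\<^sub>R (a' - b') + (s * (t * (1 - t))) *\<^sub>R v ((a, b), (a', b')) \<noteq> 0"
  shows "NGMPR (conf2 UNIV) E (\<lambda>z. bent_line (fst z) (snd z) (v z))"
proof -
  define \<Phi> where "\<Phi> = (\<lambda>z. bent_line (fst z) (snd z) (v z))"
  have EX: "subtopology (prod_topology (top_of_set (conf2 UNIV)) (top_of_set (conf2 UNIV))) E = top_of_set E"
    using E by (simp add: subtopology_subtopology inf.absorb2)
  have "continuous_on ((E \<times> {0..1}) \<times> {0..1}) (\<lambda>y. (1 - snd y) *\<^sub>R fst (fst (fst y)) + snd y *\<^sub>R snd (fst (fst y))
      + (snd (fst y) * (snd y * (1 - snd y))) *\<^sub>R (v (fst (fst y)), 0))"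
    by (intro continuous_intros continuous_on_compose2[OF v]) auto
  then have "continuous_on ((E \<times> {0..1}) \<times> {0..1}) (\<lambda>(y, t). (case y of (z, s) \<Rightarrow> \<Phi> z s) t)"
    by (rule continuous_on_eq) (auto simp: \<Phi>_def bent_line_def)
  then have c1: "continuous_map (prod_topology (top_of_set (E \<times> {0..1})) (top_of_set {0..1})) euclidean
      (\<lambda>(y, t). (case y of (z, s) \<Rightarrow> \<Phi> z s) t)" by simp
  have "continuous_map (top_of_set (E \<times> {0..1})) (path_space euclidean) (\<lambda>(z, s). \<Phi> z s)"
    by (rule continuous_map_curry[OF c1]) (auto simp: \<Phi>_def bent_line_def)
  then have c2: "continuous_map (prod_topology (top_of_set E) (top_of_set {0..1})) (path_space euclidean) (\<lambda>(z, s). \<Phi> z s)"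
    by simp
  have cont: "continuous_map (top_of_set E) (path_space (path_space euclidean)) \<Phi>"
    by (rule continuous_map_curry[OF c2]) (simp add: \<Phi>_def bent_line_def extensional_def)
  have paths: "\<Phi> z s \<in> paths_between (top_of_set X) (fst z) (snd z)"
    if z: "z \<in> E" "s \<in> {0..1}" and X: "\<And>t. t \<in> {0..1} \<Longrightarrow> \<Phi> z s t \<in> X" for z s X
  proof -
    have "continuous_on {0..1} (\<lambda>t. (1 - t) *\<^sub>R fst z + t *\<^sub>R snd z + (s * (t * (1 - t))) *\<^sub>R (v z, 0))"
      by (intro continuous_intros)
    then have "continuous_on {0..1} (\<Phi> z s)"
      by (rule continuous_on_eq) (use z in \<open>auto simp: \<Phi>_def bent_line_def\<close>)
    then show ?thesis
      using X z(2) by (auto simp: paths_between_def path_space_def topspace_compact_open_topology \<Phi>_def bent_line_def zero_prod_def)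
  qed
  have near: "near_geodesic (conf2 UNIV) (fst z) (snd z) (\<Phi> z)" if z: "z \<in> E" for z
    unfolding near_geodesic_def closure_conf2
  proof (intro conjI allI impI)
    have \<Phi>z: "\<Phi> z \<in> topspace (path_space (path_space euclidean))"
      using continuous_map_image_subset_topspace[OF cont] z by auto
    have "\<Phi> z s \<in> paths_between euclidean (fst z) (snd z)" if "s \<in> {0..1}" for s
      using paths[OF z that, of UNIV] by simp
    then show "\<Phi> z \<in> topspace (path_space (subtopology (path_space (top_of_set UNIV))
                       (paths_between (top_of_set UNIV) (fst z) (snd z))))"
      using \<Phi>z by (auto simp: path_space_def topspace_compact_open_topology continuous_map_in_subtopology)
    have "dist (\<Phi> z 0 t) (\<Phi> z 0 t') = \<bar>t - t'\<bar> * dist (fst z) (snd z)" if "t \<in> {0..1}" "t' \<in> {0..1}" for t t'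
    proof -
      have "\<Phi> z 0 t - \<Phi> z 0 t' = (t - t') *\<^sub>R (snd z - fst z)"
        using that by (simp add: \<Phi>_def bent_line_def algebra_simps)
      then show ?thesis by (simp add: dist_norm norm_minus_commute)
    qed
    then show "geodesic UNIV (fst z) (snd z) (\<Phi> z 0)"
      using paths[OF z, of 0 UNIV] by (simp add: geodesic_def)
    show "\<Phi> z ` {0<..1} \<subseteq> paths_between (top_of_set (conf2 UNIV)) (fst z) (snd z)"
    proof clarify
      fix s :: real assume s: "s \<in> {0<..1}"
      show "\<Phi> z s \<in> paths_between (top_of_set (conf2 UNIV)) (fst z) (snd z)"
      proof (rule paths[OF z])
        fix t :: real assume t: "t \<in> {0..1}"
        obtain a b a' b' where ab: "z = ((a, b), (a', b'))" by (metis surj_pair)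
        have "fst (\<Phi> z s t) - snd (\<Phi> z s t) = (1 - t) *\<^sub>R (a - b) + t *\<^sub>R (a' - b') + (s * (t * (1 - t))) *\<^sub>R v z"
          using s t by (simp add: \<Phi>_def bent_line_def ab algebra_simps)
        then have "fst (\<Phi> z s t) \<noteq> snd (\<Phi> z s t)" using avoid[of a b a' b' s t] z s t ab by auto
        then show "\<Phi> z s t \<in> conf2 UNIV" by (simp add: conf2_def split_beta)
      qed (use s in auto)
    qed
    fix s :: "nat \<Rightarrow> real" assume s: "range s \<subseteq> {0..1}" "s \<longlonglongrightarrow> 0"
    let ?D = "dist (fst z) (snd z)"
    have bounds: "ennreal ?D \<le> length_of_path (\<Phi> z r)" "length_of_path (\<Phi> z r) \<le> ennreal (?D + r * norm (v z))"
      if r: "r \<in> {0..1}" for r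
    proof -
      show "ennreal ?D \<le> length_of_path (\<Phi> z r)"
        using length_of_path_ge[of "\<Phi> z r"] r by (simp add: \<Phi>_def bent_line_def)
      show "length_of_path (\<Phi> z r) \<le> ennreal (?D + r * norm (v z))"
        unfolding \<Phi>_def using r by (intro length_of_path_le dist_bent_line_le) auto
    qed
    have "length_of_path (\<Phi> z 0) = ennreal ?D"
      using bounds[of 0] by (simp add: antisym)
    moreover have "(\<lambda>n. length_of_path (\<Phi> z (s n))) \<longlonglongrightarrow> ennreal ?D"
    proof (rule tendsto_sandwich)
      show "(\<lambda>n. ennreal ?D) \<longlonglongrightarrow> ennreal ?D" by simp
      have "(\<lambda>n. ?D + s n * norm (v z)) \<longlonglongrightarrow> ?D + 0 * norm (v z)" by (intro tendsto_intros s)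
      then show "(\<lambda>n. ennreal (?D + s n * norm (v z))) \<longlonglongrightarrow> ennreal ?D" by (auto intro: tendsto_ennrealI)
      have "s n \<in> {0..1}" for n using s(1) by blast
      then show "\<forall>\<^sub>F n in sequentially. ennreal ?D \<le> length_of_path (\<Phi> z (s n))"
        "\<forall>\<^sub>F n in sequentially. length_of_path (\<Phi> z (s n)) \<le> ennreal (?D + s n * norm (v z))"
        using bounds by (simp_all del: ennreal_plus)
    qed
    ultimately show "(\<lambda>n. length_of_path (\<Phi> z (s n))) \<longlonglongrightarrow> length_of_path (\<Phi> z 0)" by simp
  qed
  have "geodesic (conf2 UNIV) (fst z) (snd z) (\<Phi> z 0)"
    if z: "z \<in> E" and \<gamma>: "geodesic (conf2 UNIV) (fst z) (snd z) \<gamma>" for z \<gamma>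
  proof -
    have eq: "\<Phi> z 0 t = \<gamma> t" if "t \<in> {0..1}" for t
      using geodesic_eq_linepath[OF \<gamma> that] that by (simp add: \<Phi>_def bent_line_def linepath_def zero_prod_def)
    have "\<gamma> t \<in> conf2 UNIV" if "t \<in> {0..1}" for t
      using \<gamma> that by (auto simp: geodesic_def paths_between_def path_space_def topspace_compact_open_topology)
    then have "\<Phi> z 0 \<in> paths_between (top_of_set (conf2 UNIV)) (fst z) (snd z)"
      using eq by (intro paths[OF z]) auto
    then show ?thesis using \<gamma> eq by (simp add: geodesic_def)
  qed
  then show ?thesis
    unfolding NGMPR_def \<Phi>_def[symmetric] EX closure_conf2 using cont near by (fastforce)
qed

section \<open>Planning rules for opposed and for other configurations\<close>

text \<open>For nonzero difference vectors this says that one is a negative multiple of the other; without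
  divisions, the condition is visibly closed.\<close>
definition opposed :: "(('a::real_normed_vector \<times> 'a) \<times> ('a \<times> 'a)) set" where
  "opposed = {((a, b), (a', b')). norm (a - b) *\<^sub>R (a' - b') = - (norm (a' - b') *\<^sub>R (a - b))}"

lemma closed_opposed: "closed (opposed :: (('a::real_normed_vector \<times> 'a) \<times> ('a \<times> 'a)) set)"
  unfolding opposed_def split_beta by (intro closed_Collect_eq continuous_intros)

text \<open>If \<open>(1 - t) *\<^sub>R d + t *\<^sub>R d' = 0\<close> for nonzero \<open>d\<close> and \<open>d'\<close>, comparing norms shows that they are opposed.\<close>
lemma NGMPR_straight:
  fixes E :: "(('a::euclidean_space \<times> 'a) \<times> ('a \<times> 'a)) set"
  assumes E: "E \<subseteq> conf2 UNIV \<times> conf2 UNIV - opposed"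
  shows "\<exists>\<Phi>. NGMPR (conf2 UNIV) E \<Phi>"
proof -
  have "NGMPR (conf2 UNIV) E (\<lambda>z. bent_line (fst z) (snd z) 0)"
  proof (rule NGMPR_bent_lines)
    fix a b a' b' :: 'a and s t :: real
    assume z: "((a, b), (a', b')) \<in> E" and t: "t \<in> {0..1}"
    define d d' where "d = a - b" and "d' = a' - b'"
    have d: "d \<noteq> 0" "d' \<noteq> 0" "norm d *\<^sub>R d' \<noteq> - (norm d' *\<^sub>R d)"
      using subsetD[OF E z] by (auto simp: conf2_def opposed_def d_def d'_def)
    have "(1 - t) *\<^sub>R d + t *\<^sub>R d' \<noteq> 0"
    proof
      assume "(1 - t) *\<^sub>R d + t *\<^sub>R d' = 0"
      then have eq: "t *\<^sub>R d' = - ((1 - t) *\<^sub>R d)" by (simp add: eq_neg_iff_add_eq_0 add.commute)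
      have "norm (t *\<^sub>R d') = norm ((1 - t) *\<^sub>R d)" unfolding eq by simp
      then have n: "t * norm d' = (1 - t) * norm d" using t by simp
      have "t \<noteq> 0" using n d by auto
      have "t *\<^sub>R (norm d *\<^sub>R d') = norm d *\<^sub>R (t *\<^sub>R d')" by simp
      also have "\<dots> = - (((1 - t) * norm d) *\<^sub>R d)" unfolding eq by (simp add: mult.commute)
      also have "\<dots> = t *\<^sub>R (- (norm d' *\<^sub>R d))" unfolding n[symmetric] by simp
      finally show False using d(3) \<open>t \<noteq> 0\<close> by (simp only: scaleR_cancel_left simp_thms)
    qed
    then show "(1 - t) *\<^sub>R (a - b) + t *\<^sub>R (a' - b') + (s * (t * (1 - t))) *\<^sub>R 0 \<noteq> 0"
      by (simp add: d_def d'_def)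
  qed (use E in auto)
  then show ?thesis by blast
qed

text \<open>The difference vectors along the original line are multiples of the first one, \<open>d\<close>. Strictly between the
  end points, bending adds a nonzero multiple of \<open>w d\<close>, which is not a multiple of \<open>d\<close>.\<close>
lemma NGMPR_sidestep:
  fixes E :: "(('a::euclidean_space \<times> 'a) \<times> ('a \<times> 'a)) set"
  assumes E: "E \<subseteq> conf2 UNIV \<times> conf2 UNIV \<inter> opposed" and w: "continuous_on UNIV w"
    and indep: "\<And>a b z r. ((a, b), z) \<in> E \<Longrightarrow> w (a - b) \<noteq> r *\<^sub>R (a - b)"
  shows "\<exists>\<Phi>. NGMPR (conf2 UNIV) E \<Phi>"
proof -
  have "NGMPR (conf2 UNIV) E (\<lambda>z. bent_line (fst z) (snd z) (w (fst (fst z) - snd (fst z))))"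
  proof (rule NGMPR_bent_lines)
    show "continuous_on E (\<lambda>z. w (fst (fst z) - snd (fst z)))"
      by (intro continuous_on_compose2[OF w] continuous_intros) auto
    fix a b a' b' :: 'a and s t :: real
    assume z: "((a, b), (a', b')) \<in> E" and s: "s \<in> {0<..1}" and t: "t \<in> {0..1}"
    define d d' where "d = a - b" and "d' = a' - b'"
    have d: "d \<noteq> 0" "d' \<noteq> 0" "norm d *\<^sub>R d' = - (norm d' *\<^sub>R d)"
      using subsetD[OF E z] by (auto simp: conf2_def opposed_def d_def d'_def)
    define q where "q = norm d' / norm d"
    have "norm d *\<^sub>R d' = norm d *\<^sub>R (- (q *\<^sub>R d))" using d by (simp add: q_def)
    then have d': "d' = - (q *\<^sub>R d)" using d(1) by (simp only: scaleR_cancel_left) simp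
    have "(1 - t) *\<^sub>R d + t *\<^sub>R d' + (s * (t * (1 - t))) *\<^sub>R w d \<noteq> 0"
    proof
      assume 0: "(1 - t) *\<^sub>R d + t *\<^sub>R d' + (s * (t * (1 - t))) *\<^sub>R w d = 0"
      define c where "c = s * (t * (1 - t))"
      have "t \<noteq> 0" "t \<noteq> 1" using 0 d by auto
      then have "c \<noteq> 0" using s by (simp add: c_def)
      have "c *\<^sub>R w d = (t * q - (1 - t)) *\<^sub>R d"
        using 0 unfolding c_def[symmetric] d' by (simp add: algebra_simps eq_neg_iff_add_eq_0)
      then have "w d = ((t * q - (1 - t)) / c) *\<^sub>R d"
        using \<open>c \<noteq> 0\<close> by (metis divideR_right scaleR_scaleR divide_inverse mult.commute)
      then show False using indep[OF z] by (simp add: d_def)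
    qed
    then show "(1 - t) *\<^sub>R (a - b) + t *\<^sub>R (a' - b') + (s * (t * (1 - t))) *\<^sub>R
       w (fst (fst ((a, b), a', b')) - snd (fst ((a, b), a', b'))) \<noteq> 0"
      by (simp add: d_def d'_def)
  qed (use E in auto)
  then show ?thesis by blast
qed

text \<open>The basis is split into two halves that are matched by a bijection \<open>f\<close>; in each plane
  spanned by \<open>u\<close> and \<open>f u\<close>, the map \<open>J\<close> is the rotation by a right angle.\<close>
lemma even_dim_skew_map:
  assumes "even DIM('a::euclidean_space)"
  obtains J :: "'a \<Rightarrow> 'a::euclidean_space" where "continuous_on UNIV J" "\<And>x. J x \<bullet> x = 0" "\<And>x. J x = 0 \<Longrightarrow> x = 0"
proof -
  obtain A :: "'a set" where A: "A \<subseteq> Basis" "card A = DIM('a) div 2"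
    by (rule obtain_subset_with_card_n[of "DIM('a) div 2" "Basis :: 'a set"]) auto
  have fin: "finite A" by (rule finite_subset[OF A(1) finite_Basis])
  have "card (Basis - A) = card A"
    using A assms by (auto simp: card_Diff_subset[OF fin] elim!: evenE)
  then obtain f where f: "bij_betw f A (Basis - A)"
    using finite_same_card_bij[OF fin, of "Basis - A"] by auto
  define J where "J = (\<lambda>x. \<Sum>u\<in>A. (x \<bullet> u) *\<^sub>R f u - (x \<bullet> f u) *\<^sub>R u)"
  have fB: "f u \<in> Basis" "f u \<notin> A" if "u \<in> A" for u using f that by (auto simp: bij_betw_def)
  have inj: "f u = f c \<longleftrightarrow> u = c" if "u \<in> A" "c \<in> A" for u c using f that by (auto simp: bij_betw_def inj_on_def)
  show thesis
  proof (rule that[of J])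
    show "continuous_on UNIV J" unfolding J_def by (intro continuous_intros)
    show "J x \<bullet> x = 0" for x
      unfolding J_def inner_sum_left inner_diff_left inner_scaleR_left
      by (intro sum.neutral ballI) (simp add: inner_commute)
    show "x = 0" if 0: "J x = 0" for x
    proof -
      have 1: "J x \<bullet> f c = x \<bullet> c" "J x \<bullet> c = - (x \<bullet> f c)" if c: "c \<in> A" for c
      proof -
        have ne: "f u \<noteq> c" "c \<noteq> f u" if "u \<in> A" for u using fB(2)[OF that] c by metis+
        have "J x \<bullet> f c = (\<Sum>u\<in>A. if u = c then x \<bullet> u else 0)"
          unfolding J_def inner_sum_left
          by (intro sum.cong refl) (use c A fB inj ne in \<open>auto simp: inner_diff_left inner_Basis subset_iff\<close>)
        then show "J x \<bullet> f c = x \<bullet> c" using c fin by simp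
        have "J x \<bullet> c = (\<Sum>u\<in>A. if u = c then - (x \<bullet> f u) else 0)"
          unfolding J_def inner_sum_left
          by (intro sum.cong refl) (use c A fB inj ne in \<open>auto simp: inner_diff_left inner_Basis subset_iff\<close>)
        then show "J x \<bullet> c = - (x \<bullet> f c)" using c fin by simp
      qed
      have "x \<bullet> u = 0" if "u \<in> Basis" for u
      proof (cases "u \<in> A")
        case True then show ?thesis using 1(1)[of u] 0 by simp
      next
        case False
        then have "u \<in> f ` A" using f that by (simp add: bij_betw_def)
        then obtain c where "c \<in> A" "u = f c" by blast
        then show ?thesis using 1(2)[of c] 0 by simp
      qed
      then show ?thesis using euclidean_all_zero_iff[of x] by blast
    qed
  qed
qed

section \<open>Upper bound for the geodesic complexity\<close>

lemma locally_compact_in_conf2: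
  fixes C U :: "(('a::euclidean_space \<times> 'a) \<times> ('a \<times> 'a)) set"
  assumes "closed C" "open U"
  shows "locally_compact_space (subtopology (prod_topology (top_of_set (conf2 UNIV))
           (top_of_set (conf2 UNIV))) (conf2 UNIV \<times> conf2 UNIV \<inter> C \<inter> U))"
proof -
  have "open {x :: 'a \<times> 'a. fst x \<noteq> snd x}" by (intro open_Collect_neq continuous_intros)
  also have "{x :: 'a \<times> 'a. fst x \<noteq> snd x} = conf2 UNIV" by (auto simp: conf2_def)
  finally have "open ((conf2 UNIV :: ('a \<times> 'a) set) \<times> (conf2 UNIV :: ('a \<times> 'a) set) \<inter> U)"
    using assms(2) by (intro open_Int open_Times)
  then have "locally_compact_space (subtopology euclidean (C \<inter> (conf2 (UNIV::'a set) \<times> conf2 UNIV \<inter> U)))"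
    using locally_compact_subspace_closed_Int_openin_eq[of euclidean "C \<inter> (conf2 (UNIV::'a set) \<times> conf2 UNIV \<inter> U)"]
      assms(1) locally_compact_space_euclidean by auto
  moreover have "conf2 UNIV \<times> conf2 UNIV \<inter> (conf2 UNIV \<times> conf2 UNIV \<inter> C \<inter> U) = C \<inter> (conf2 (UNIV::'a set) \<times> conf2 UNIV \<inter> U)"
    by blast
  ultimately show ?thesis by (simp only: prod_topology_subtopology_eu subtopology_subtopology)
qed

theorem GC_conf2_upper_bound:
  assumes "DIM('a::euclidean_space) \<ge> 2"
  shows "GC (conf2 (UNIV :: 'a set)) \<le> (if even DIM('a) then 1 else 2)"
proof -
  let ?X = "conf2 (UNIV :: 'a set)" and ?T = "prod_topology (top_of_set (conf2 (UNIV :: 'a set))) (top_of_set (conf2 UNIV))"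
  have bound: "GC ?X \<le> enat k"
    if "locally_compact_partition ?T k E" "\<And>i. i \<le> k \<Longrightarrow> \<exists>\<Phi>. NGMPR ?X (E i) \<Phi>" for k E
    unfolding GC_def using that by (intro Inf_lower) blast
  have op: "open (- opposed :: (('a \<times> 'a) \<times> ('a \<times> 'a)) set)" by (intro open_Compl closed_opposed)
  have lc0: "locally_compact_space (subtopology ?T (?X \<times> ?X - opposed))"
    using locally_compact_in_conf2[OF closed_UNIV op] by (simp add: Diff_eq)
  show ?thesis
  proof (cases "even DIM('a)")
    case True
    obtain J :: "'a \<Rightarrow> 'a" where J: "continuous_on UNIV J" "\<And>x. J x \<bullet> x = 0" "\<And>x. J x = 0 \<Longrightarrow> x = 0"
      using even_dim_skew_map[OF True] by blast
    define E where "E = (\<lambda>i::nat. if i = 0 then ?X \<times> ?X - opposed else ?X \<times> ?X \<inter> opposed)"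
    have "GC ?X \<le> enat 1"
    proof (rule bound[of 1 E])
      have "locally_compact_space (subtopology ?T (?X \<times> ?X \<inter> opposed))"
        using locally_compact_in_conf2[OF closed_opposed open_UNIV] by simp
      then show "locally_compact_partition ?T 1 E"
        using lc0 by (auto simp: locally_compact_partition_def E_def disjoint_family_on_def atMost_Suc)
      fix i :: nat assume "i \<le> 1"
      have "\<exists>\<Phi>. NGMPR ?X (?X \<times> ?X \<inter> opposed) \<Phi>"
      proof (rule NGMPR_sidestep[OF order_refl J(1)])
        fix a b :: 'a and z r assume z: "((a, b), z) \<in> ?X \<times> ?X \<inter> opposed"
        show "J (a - b) \<noteq> r *\<^sub>R (a - b)"
        proof
          assume eq: "J (a - b) = r *\<^sub>R (a - b)"
          then have "r * ((a - b) \<bullet> (a - b)) = 0" using J(2)[of "a - b"] by simp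
          then have "J (a - b) = 0" using eq by auto
          then show False using J(3)[of "a - b"] z by (auto simp: conf2_def)
        qed
      qed
      then show "\<exists>\<Phi>. NGMPR ?X (E i) \<Phi>"
        using NGMPR_straight[OF order_refl] by (auto simp: E_def)
    qed
    then show ?thesis using True by (simp add: one_enat_def)
  next
    case False
    obtain e e' :: 'a where e: "e \<in> Basis" "e' \<in> Basis" "e \<noteq> e'"
      using assms card_le_Suc0_iff_eq[of "Basis :: 'a set"] by fastforce
    have ee: "e \<bullet> e = 1" "e' \<bullet> e' = 1" "e' \<bullet> e = 0" using e by (auto simp: inner_Basis)
    \<comment> \<open>Only for difference vectors parallel to \<open>e\<close> does bending in the direction \<open>e\<close> fail; there \<open>e'\<close> takes over.\<close>
    define par :: "(('a \<times> 'a) \<times> ('a \<times> 'a)) set" where "par = {((a, b), z). a - b = ((a - b) \<bullet> e) *\<^sub>R e}"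
    have clo: "closed par"
      unfolding par_def split_beta by (intro closed_Collect_eq continuous_intros)
    then have opp: "open (- par)" by (simp add: open_Compl)
    define E where "E = (\<lambda>i::nat. if i = 0 then ?X \<times> ?X - opposed else
      if i = 1 then ?X \<times> ?X \<inter> opposed \<inter> - par else ?X \<times> ?X \<inter> (opposed \<inter> par))"
    have "GC ?X \<le> enat 2"
    proof (rule bound[of 2 E])
      have "locally_compact_space (subtopology ?T (?X \<times> ?X \<inter> opposed \<inter> - par))"
        by (rule locally_compact_in_conf2[OF closed_opposed opp])
      moreover have "locally_compact_space (subtopology ?T (?X \<times> ?X \<inter> (opposed \<inter> par)))"
        using locally_compact_in_conf2[OF closed_Int[OF closed_opposed clo] open_UNIV] by simp
      ultimately show "locally_compact_partition ?T 2 E"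
        using lc0 by (auto simp: locally_compact_partition_def E_def disjoint_family_on_def numeral_2_eq_2 atMost_Suc)
      fix i :: nat assume "i \<le> 2"
      have 1: "\<exists>\<Phi>. NGMPR ?X (?X \<times> ?X \<inter> opposed \<inter> - par) \<Phi>"
      proof (rule NGMPR_sidestep[OF _ continuous_on_const[of _ e]])
        fix a b :: 'a and z r assume z: "((a, b), z) \<in> ?X \<times> ?X \<inter> opposed \<inter> - par"
        show "e \<noteq> r *\<^sub>R (a - b)"
        proof
          assume eq: "e = r *\<^sub>R (a - b)"
          then have "r \<noteq> 0" using ee by auto
          then have ab: "a - b = inverse r *\<^sub>R e" using eq by simp
          then have "(a - b) \<bullet> e = inverse r" using ee by simp
          then show False using z ab by (simp add: par_def)
        qed
      qed auto
      have 2: "\<exists>\<Phi>. NGMPR ?X (?X \<times> ?X \<inter> (opposed \<inter> par)) \<Phi>"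
      proof (rule NGMPR_sidestep[OF _ continuous_on_const[of _ e']])
        fix a b :: 'a and z r assume z: "((a, b), z) \<in> ?X \<times> ?X \<inter> (opposed \<inter> par)"
        show "e' \<noteq> r *\<^sub>R (a - b)"
        proof
          assume eq: "e' = r *\<^sub>R (a - b)"
          have "a - b = ((a - b) \<bullet> e) *\<^sub>R e" using z by (simp add: par_def)
          then have "e' = (r * ((a - b) \<bullet> e)) *\<^sub>R e" using eq by (metis scaleR_scaleR)
          then have "e' \<bullet> e' = (r * ((a - b) \<bullet> e)) * (e' \<bullet> e)" by (metis inner_scaleR_right)
          then show False using ee by simp
        qed
      qed auto
      show "\<exists>\<Phi>. NGMPR ?X (E i) \<Phi>"
        using 1 2 NGMPR_straight[OF order_refl] by (auto simp: E_def)
    qed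
    then show ?thesis using False by (simp add: numeral_eq_enat)
  qed
qed

section \<open>Complexity of the configuration space\<close>

theorem theorem2p6:
  assumes "CARD('n::finite) \<ge> 2"
  shows "GC (conf2 (UNIV :: (real ^ 'n) set)) = TC (top_of_set (conf2 (UNIV :: (real ^ 'n) set)))
      \<and> TC (top_of_set (conf2 (UNIV :: (real ^ 'n) set))) = (if even CARD('n) then 1 else 2)"
proof -
  have "DIM(real ^ 'n) = CARD('n)" by simp
  then have lower: "(if even CARD('n) then 1 else 2) \<le> TC (top_of_set (conf2 (UNIV :: (real ^ 'n) set)))"
    and upper: "GC (conf2 (UNIV :: (real ^ 'n) set)) \<le> (if even CARD('n) then 1 else 2)"
    using TC_conf2_lower_bound[where 'a = "real ^ 'n"] GC_conf2_upper_bound[where 'a = "real ^ 'n"] assms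
    by simp_all
  have mid: "TC (top_of_set (conf2 (UNIV :: (real ^ 'n) set))) \<le> GC (conf2 (UNIV :: (real ^ 'n) set))"
    by (rule TC_le_GC)
  show ?thesis
    using order_antisym[OF order_trans[OF upper lower] mid] order_antisym[OF order_trans[OF mid upper] lower]
    by blast
qed

end
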